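(* Let $n\ge 3$, let $K$ be a field, let $\mathcal{A}=K[x_0,x_1,\ldots,x_{2n}]$, and let $L=CNI(H_{0,2n})\subseteq\mathcal{A}$ be the closed neighborhood ideal of the Helm graph $H_{0,2n}$. Then $$\operatorname{depth}(\mathcal{A}/L)=n.$$
   Context: For $n\ge 3$, the Helm graph $H_{0,2n}$ is the simple graph with vertex set $\{x_0,x_1,\ldots,x_n,x_{n+1},\ldots,x_{2n}\}$ and edge set $$E(C_n)\cup\{\{x_0,x_i\}:1\le i\le n\}\cup\{\{x_i,x_{n+i}\}:1\le i\le n\},$$ where $E(C_n)=\{\{x_i,x_{i+1}\}:1\le i\le n-1\}\cup\{\{x_n,x_1\}\}$. The closed neighborhood ideal $CNI(G)$ of a graph $G$ is the monomial ideal generated by the products $\prod_{x_j\in N[x_i]}x_j$ for $x_i\in V(G)$, where $N[x_i]=\{x_i\}\cup\{x_j:\{x_i,x_j\}\in E(G)\}$. For the Helm graph, $$L=CNI(H_{0,2n})=(x_1x_{n+1},\,x_2x_{n+2},\ldots,x_nx_{2n},\,x_0x_1x_2\cdots x_n).$$ The depth of a finitely generated $\mathcal{A}$-module $M$ is the length of a maximal $M$-regular sequence in the graded maximal ideal $(x_0,\dots,x_{2n})$. *)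

theory Defs
  imports
    "HOL-Library.Poly_Mapping"
    "HOL-Algebra.Module"
    "HOL-Algebra.QuotRing"
begin

section \<open>Polynomial rings\<close>

text \<open>
  Polynomials over \<open>'k\<close> in the variables \<open>x\<^sub>i\<close>, \<open>i :: nat\<close>: finitely supported functions from
  exponent vectors to coefficients, with the convolution product of \<^theory>\<open>HOL-Library.Poly_Mapping\<close>.
  The variable set \<open>V\<close> is imposed through the carrier of the ring.
\<close>

type_synonym 'k mpoly = "(nat \<Rightarrow>\<^sub>0 nat) \<Rightarrow>\<^sub>0 'k"

definition indets :: "'k::zero mpoly \<Rightarrow> nat set" where
  "indets p = (\<Union>m\<in>Poly_Mapping.keys p. Poly_Mapping.keys m)"

definition pvar :: "nat \<Rightarrow> 'k::zero_neq_one mpoly" where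
  "pvar i = Poly_Mapping.single (Poly_Mapping.single i 1) 1"

definition poly_ring :: "nat set \<Rightarrow> 'k::field mpoly ring" where
  "poly_ring V =
     \<lparr>carrier = {p. indets p \<subseteq> V}, mult = (*), one = 1, zero = 0, add = (+)\<rparr>"

text \<open>For finite \<open>V\<close> this is the graded maximal ideal of \<^term>\<open>poly_ring V\<close>.\<close>

definition graded_maximal_ideal :: "nat set \<Rightarrow> 'k::field mpoly set" where
  "graded_maximal_ideal V = Idl\<^bsub>poly_ring V\<^esub> (pvar ` V)"


section \<open>Modules, regular sequences and depth\<close>

text \<open>
  A module record extends a ring record; its fields \<open>mult\<close> and \<open>one\<close> play no role below.
\<close>

definition self_module :: "'a ring \<Rightarrow> ('a, 'a) module" where
  "self_module R = ring.extend R \<lparr>smult = mult R\<rparr>"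

text \<open>
  \<open>M / N\<close>. The carrier, zero and addition of \<open>M Quot N\<close> only use the additive group of \<open>M\<close>; a scalar
  acts by \<open>a \<cdot> (N + x) = N + a x\<close>, written as a union over all representatives \<open>x\<close> of the coset.
\<close>

definition quotient_module :: "('a, 'b) module \<Rightarrow> 'b set \<Rightarrow> ('a, 'b set) module" where
  "quotient_module M N =
     ring.extend (M Quot N) \<lparr>smult = (\<lambda>a X. \<Union>x\<in>X. N +>\<^bsub>M\<^esub> (a \<odot>\<^bsub>M\<^esub> x))\<rparr>"

text \<open>\<open>(S)M\<close>, the submodule generated by all products \<open>a x\<close> with \<open>a \<in> S\<close> and \<open>x \<in> M\<close>.\<close>

definition smult_submodule :: "'a ring \<Rightarrow> 'a set \<Rightarrow> ('a, 'b) module \<Rightarrow> 'b set" where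
  "smult_submodule R S M =
     \<Inter>{N. submodule N R M \<and> (\<forall>a\<in>S. \<forall>x\<in>carrier M. a \<odot>\<^bsub>M\<^esub> x \<in> N)}"

definition nonzerodivisor_on :: "'a \<Rightarrow> ('a, 'b) module \<Rightarrow> bool" where
  "nonzerodivisor_on a M \<longleftrightarrow> (\<forall>x\<in>carrier M. a \<odot>\<^bsub>M\<^esub> x = \<zero>\<^bsub>M\<^esub> \<longrightarrow> x = \<zero>\<^bsub>M\<^esub>)"

definition regular_sequence :: "'a ring \<Rightarrow> ('a, 'b) module \<Rightarrow> 'a list \<Rightarrow> bool" where
  "regular_sequence R M fs \<longleftrightarrow>
     set fs \<subseteq> carrier R \<and>
     (\<forall>i<length fs.
        nonzerodivisor_on (fs ! i)
          (quotient_module M (smult_submodule R (set (take i fs)) M))) \<and>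
     smult_submodule R (set fs) M \<noteq> carrier M"

definition maximal_regular_sequence_in ::
    "'a ring \<Rightarrow> 'a set \<Rightarrow> ('a, 'b) module \<Rightarrow> 'a list \<Rightarrow> bool" where
  "maximal_regular_sequence_in R I M fs \<longleftrightarrow>
     regular_sequence R M fs \<and> set fs \<subseteq> I \<and>
     (\<forall>g\<in>I. \<not> regular_sequence R M (fs @ [g]))"

text \<open>
  The length of a maximal \<open>M\<close>-regular sequence in \<open>I\<close>. It is determined as soon as a maximal
  sequence exists and all of them have the same length, which holds for finitely generated modules
  \<open>M \<noteq> I M\<close> over Noetherian rings.
\<close>

definition depth :: "'a ring \<Rightarrow> 'a set \<Rightarrow> ('a, 'b) module \<Rightarrow> nat" where
  "depth R I M = (THE r. \<exists>fs. maximal_regular_sequence_in R I M fs \<and> length fs = r)"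


section \<open>Closed neighborhood ideals and Helm graphs\<close>

definition closed_neighborhood :: "nat set set \<Rightarrow> nat \<Rightarrow> nat set" where
  "closed_neighborhood E i = {i} \<union> {j. {i, j} \<in> E}"

definition CNI :: "nat set \<Rightarrow> nat set set \<Rightarrow> 'k::field mpoly set" where
  "CNI V E = Idl\<^bsub>poly_ring V\<^esub> ((\<lambda>i. \<Prod>j\<in>closed_neighborhood E i. pvar j) ` V)"

text \<open>The vertex \<open>x\<^sub>i\<close> is represented by its index \<open>i\<close>.\<close>

definition cycle_edges :: "nat \<Rightarrow> nat set set" where
  "cycle_edges n = {{i, i + 1} | i. 1 \<le> i \<and> i \<le> n - 1} \<union> {{n, 1}}"

definition helm_vertices :: "nat \<Rightarrow> nat set" where
  "helm_vertices n = {0..2 * n}"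

definition helm_edges :: "nat \<Rightarrow> nat set set" where
  "helm_edges n =
     cycle_edges n \<union> {{0, i} | i. 1 \<le> i \<and> i \<le> n} \<union> {{i, n + i} | i. 1 \<le> i \<and> i \<le> n}"

end

theory Submission
  imports Defs "HOL.Topological_Spaces"
begin

text \<open>
  Write \<open>A\<close> for the polynomial ring, \<open>m\<close> for its graded maximal ideal and \<open>y\<^sub>j\<close> for \<open>x\<^sub>n\<^sub>+\<^sub>j\<close>. The ideal is
  \<open>L = (x\<^sub>1 y\<^sub>1, \<dots>, x\<^sub>n y\<^sub>n, x\<^sub>0 x\<^sub>1 \<cdots> x\<^sub>n)\<close>, and \<open>x\<^sub>1 - y\<^sub>1, \<dots>, x\<^sub>n - y\<^sub>n\<close> is a regular sequence on \<open>A/L\<close>.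
  Dividing out the first \<open>k\<close> differences replaces \<open>y\<^sub>j\<close> by \<open>x\<^sub>j\<close> for \<open>j \<le> k\<close> and leaves a monomial ideal
  (\<open>helm_adjoin_iff\<close>), in which \<open>x\<close> and \<open>y\<close> with index \<open>k + 1\<close> occur in so simple a way that their difference
  is visibly a nonzerodivisor (\<open>helm_regular_nonzerodivisor\<close>). After all \<open>n\<close> steps the quotient is
  \<open>K[x\<^sub>0, \<dots>, x\<^sub>n] / (x\<^sub>1\<^sup>2, \<dots>, x\<^sub>n\<^sup>2, x\<^sub>0 \<cdots> x\<^sub>n)\<close>, where the nonzero element \<open>x\<^sub>1 \<cdots> x\<^sub>n\<close> is annihilated by
  every variable (\<open>helm_socle\<close>). So this sequence is maximal in \<open>m\<close>.

  The depth is described as the unique length of a maximal regular sequence, and the elements of such a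
  sequence may be arbitrary, inhomogeneous members of \<open>m\<close>. It therefore remains to show that all maximal
  sequences have the same length (Rees). Ext groups are avoided by an elementary exchange argument, as in
  Kaplansky's Commutative Rings. If \<open>f\<close> and \<open>g\<close> are both regular modulo \<open>I\<close>, then the quotients by \<open>I + (f)\<close>
  and by \<open>I + (g)\<close> either both have a nonzero element annihilated by \<open>m\<close> or both have none
  (\<open>socle_nonzero_transfer\<close>). Longer sequences are compared through an element \<open>z\<close> that is regular on all
  quotients involved and can be moved past \<open>f\<close> and past \<open>g\<close> (\<open>reg_depth_adjoin\<close>).

  The existence of \<open>z\<close> is where finiteness enters. In a Noetherian ring the zero divisors modulo an ideal are
  covered by finitely many primes \<open>(I : u)\<close>, and prime avoidance yields an element of \<open>m\<close> outside all of them
  (\<open>common_nonzerodivisor\<close>). That the polynomial ring is Noetherian follows from Dickson's lemma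
  (\<open>polys_noetherian\<close>).
\<close>

section \<open>Ideals in a subring\<close>

text \<open>
  The ring is a subset \<open>A\<close> of a commutative ring type, so that the number of variables of a polynomial
  ring can be a term while sums and products are those of the type, where the algebraic simplifiers apply.
\<close>

locale subring_ideals =
  fixes A :: "'a::comm_ring_1 set"
  assumes zero_mem [simp]: "0 \<in> A" and one_mem [simp]: "1 \<in> A"
    and add_mem [simp]: "\<And>x y. x \<in> A \<Longrightarrow> y \<in> A \<Longrightarrow> x + y \<in> A"
    and uminus_mem [simp]: "\<And>x. x \<in> A \<Longrightarrow> - x \<in> A"
    and mult_mem [simp]: "\<And>x y. x \<in> A \<Longrightarrow> y \<in> A \<Longrightarrow> x * y \<in> A"
begin

lemma diff_mem [simp]: "x \<in> A \<Longrightarrow> y \<in> A \<Longrightarrow> x - y \<in> A"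
  using add_mem[of x "- y"] by simp

definition is_ideal :: "'a set \<Rightarrow> bool" where
  "is_ideal I \<longleftrightarrow> I \<subseteq> A \<and> 0 \<in> I \<and> (\<forall>x\<in>I. \<forall>y\<in>I. x + y \<in> I) \<and> (\<forall>a\<in>A. \<forall>x\<in>I. a * x \<in> I)"

lemma is_idealI:
  assumes "I \<subseteq> A" "0 \<in> I" "\<And>x y. x \<in> I \<Longrightarrow> y \<in> I \<Longrightarrow> x + y \<in> I"
    "\<And>a x. a \<in> A \<Longrightarrow> x \<in> I \<Longrightarrow> a * x \<in> I"
  shows "is_ideal I"
  using assms by (auto simp: is_ideal_def)

lemma ideal_carrier: "is_ideal I \<Longrightarrow> x \<in> I \<Longrightarrow> x \<in> A"
  and ideal_zero: "is_ideal I \<Longrightarrow> 0 \<in> I"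
  and ideal_add: "is_ideal I \<Longrightarrow> x \<in> I \<Longrightarrow> y \<in> I \<Longrightarrow> x + y \<in> I"
  and ideal_mult: "is_ideal I \<Longrightarrow> a \<in> A \<Longrightarrow> x \<in> I \<Longrightarrow> a * x \<in> I"
  by (auto simp: is_ideal_def)

lemma ideal_mult_right: "is_ideal I \<Longrightarrow> a \<in> A \<Longrightarrow> x \<in> I \<Longrightarrow> x * a \<in> I"
  using ideal_mult by (simp add: mult.commute)

lemma ideal_uminus: "is_ideal I \<Longrightarrow> x \<in> I \<Longrightarrow> - x \<in> I"
  using ideal_mult[of I "- 1" x] by simp

lemma ideal_diff: "is_ideal I \<Longrightarrow> x \<in> I \<Longrightarrow> y \<in> I \<Longrightarrow> x - y \<in> I"
  using ideal_add[of I x "- y"] ideal_uminus[of I y] by simp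

lemma ideal_diff_iff: "is_ideal I \<Longrightarrow> x - y \<in> I \<Longrightarrow> x \<in> I \<longleftrightarrow> y \<in> I"
  using ideal_diff[of I x "x - y"] ideal_add[of I "x - y" y] by auto

lemma ideal_sum:
  "is_ideal I \<Longrightarrow> (\<And>i. i \<in> S \<Longrightarrow> f i \<in> I) \<Longrightarrow> sum f S \<in> I"
  by (induction S rule: infinite_finite_induct) (auto intro: ideal_zero ideal_add)

definition adjoin :: "'a set \<Rightarrow> 'a \<Rightarrow> 'a set" where
  "adjoin I f = {p + a * f | p a. p \<in> I \<and> a \<in> A}"

lemma adjoinE:
  assumes "x \<in> adjoin I f" obtains p a where "x = p + a * f" "p \<in> I" "a \<in> A"
  using assms by (auto simp: adjoin_def)

lemma adjoinI: "p \<in> I \<Longrightarrow> a \<in> A \<Longrightarrow> p + a * f \<in> adjoin I f"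
  by (auto simp: adjoin_def)

lemma is_ideal_adjoin:
  assumes I: "is_ideal I" and f: "f \<in> A"
  shows "is_ideal (adjoin I f)"
proof (rule is_idealI)
  show "adjoin I f \<subseteq> A" using ideal_carrier[OF I] f by (auto simp: adjoin_def)
  show "0 \<in> adjoin I f" using adjoinI[OF ideal_zero[OF I] zero_mem, of f] by simp
next
  fix x y assume "x \<in> adjoin I f" "y \<in> adjoin I f"
  then obtain p a q b where x: "x = p + a * f" "p \<in> I" "a \<in> A" and y: "y = q + b * f" "q \<in> I" "b \<in> A"
    by (metis adjoinE)
  show "x + y \<in> adjoin I f"
    using adjoinI[of "p + q" I "a + b" f] x y ideal_add[OF I] by (simp add: algebra_simps)
next
  fix c x assume c: "c \<in> A" and "x \<in> adjoin I f"
  then obtain p a where x: "x = p + a * f" "p \<in> I" "a \<in> A" by (metis adjoinE)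
  show "c * x \<in> adjoin I f"
    using adjoinI[of "c * p" I "c * a" f] x c ideal_mult[OF I] by (simp add: algebra_simps)
qed

lemma adjoin_superset: "I \<subseteq> adjoin I f"
  using adjoinI[OF _ zero_mem, of _ I f] by auto

lemma adjoin_self: "is_ideal I \<Longrightarrow> f \<in> adjoin I f"
  using adjoinI[OF ideal_zero one_mem, of I f] by simp

lemma adjoin_least: "is_ideal J \<Longrightarrow> I \<subseteq> J \<Longrightarrow> f \<in> J \<Longrightarrow> adjoin I f \<subseteq> J"
  by (auto elim!: adjoinE intro!: ideal_add ideal_mult)

lemma adjoin_commute_le: 
  assumes "is_ideal I" "f \<in> A" "g \<in> A" shows "adjoin (adjoin I f) g \<subseteq> adjoin (adjoin I g) f"
proof -
  have id: "is_ideal (adjoin I g)" "is_ideal (adjoin (adjoin I g) f)" using assms by (simp_all add: is_ideal_adjoin)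
  have "adjoin I f \<subseteq> adjoin (adjoin I g) f"
    using adjoin_least[OF id(2)] adjoin_superset[of I g] adjoin_superset[of "adjoin I g" f] adjoin_self[OF id(1)] by blast
  then show ?thesis using adjoin_least[OF id(2)] adjoin_self[OF assms(1)] adjoin_superset by blast
qed

lemma adjoin_commute:
  "is_ideal I \<Longrightarrow> f \<in> A \<Longrightarrow> g \<in> A \<Longrightarrow> adjoin (adjoin I f) g = adjoin (adjoin I g) f"
  by (intro equalityI adjoin_commute_le)

section \<open>Regular elements and the socle\<close>

definition nzd_mod :: "'a set \<Rightarrow> 'a \<Rightarrow> bool" where
  "nzd_mod I f \<longleftrightarrow> (\<forall>p\<in>A. f * p \<in> I \<longrightarrow> p \<in> I)"

text \<open>
  This says that \<open>Hom(A/m, A/I)\<close> is nonzero: some nonzero element of \<open>A/I\<close> is annihilated by \<open>m\<close>.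
\<close>

definition socle_nonzero :: "'a set \<Rightarrow> 'a set \<Rightarrow> bool" where
  "socle_nonzero m I \<longleftrightarrow> (\<exists>u\<in>A. u \<notin> I \<and> (\<forall>g\<in>m. g * u \<in> I))"

text \<open>
  Some \<open>A/I\<close>-regular sequence of length \<open>k\<close> in \<open>m\<close> ends at a quotient with nonzero socle. Homologically,
  \<open>Ext\<^sup>k(A/m, A/I)\<close> is nonzero while all lower ones vanish. Peeling off one element at a time is what
  makes the exchange argument below an induction.
\<close>

fun reg_depth :: "'a set \<Rightarrow> nat \<Rightarrow> 'a set \<Rightarrow> bool" where
  "reg_depth m 0 I \<longleftrightarrow> socle_nonzero m I"
| "reg_depth m (Suc k) I \<longleftrightarrow> (\<exists>f\<in>m. nzd_mod I f \<and> reg_depth m k (adjoin I f))"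

text \<open>
  A regular pair may be exchanged in its last place: if \<open>f p = q + b z\<close>, then \<open>b z\<close> vanishes modulo
  \<open>I + (f)\<close>, hence so does \<open>b\<close>, and cancelling \<open>f\<close> moves \<open>p\<close> into \<open>I + (z)\<close>. The other half, regularity
  of \<open>z\<close> modulo \<open>I\<close> itself, can fail outside local rings; it is arranged by the choice of \<open>z\<close> in
  \<open>reg_depth_adjoin\<close>.
\<close>

lemma nzd_swap:
  assumes I: "is_ideal I" and f: "f \<in> A" and z: "z \<in> A"
    and nf: "nzd_mod I f" and nz: "nzd_mod (adjoin I f) z"
  shows "nzd_mod (adjoin I z) f"
  unfolding nzd_mod_def
proof (intro ballI impI)
  fix p assume p: "p \<in> A" and "f * p \<in> adjoin I z"
  then obtain q b where qb: "f * p = q + b * z" "q \<in> I" "b \<in> A" by (metis adjoinE)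
  have "z * b = - q + p * f" using qb by (simp add: algebra_simps)
  also have "\<dots> \<in> adjoin I f" by (rule adjoinI) (use ideal_uminus[OF I] qb p in auto)
  finally have "b \<in> adjoin I f" using nz qb by (auto simp: nzd_mod_def)
  then obtain r c where rc: "b = r + c * f" "r \<in> I" "c \<in> A" by (metis adjoinE)
  have "f * (p - c * z) = q + z * r" using qb rc by (simp add: algebra_simps)
  also have "\<dots> \<in> I" using I qb rc z by (auto intro: ideal_add ideal_mult)
  finally have "p - c * z \<in> I" using nf p rc z by (auto simp: nzd_mod_def)
  from adjoinI[OF this rc(3), of z] show "p \<in> adjoin I z" by simp
qed

text \<open>
  Both socles are \<open>Ext\<^sup>1(A/m, A/I)\<close>. Concretely, if \<open>u\<close> represents a socle element modulo \<open>I + (f)\<close>, then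
  \<open>g u = v f\<close> modulo \<open>I\<close>, and \<open>v\<close> represents one modulo \<open>I + (g)\<close>: the fraction \<open>u / f = v / g\<close> is the
  element of the Ext group that both describe.
\<close>

lemma socle_nonzero_transfer:
  assumes I: "is_ideal I" and m: "m \<subseteq> A" and f: "f \<in> m" and g: "g \<in> m"
    and nf: "nzd_mod I f" and ng: "nzd_mod I g"
    and s: "socle_nonzero m (adjoin I f)"
  shows "socle_nonzero m (adjoin I g)"
proof -
  have fA: "f \<in> A" and gA: "g \<in> A" using f g m by auto
  from s obtain u where u: "u \<in> A" "u \<notin> adjoin I f" "\<And>h. h \<in> m \<Longrightarrow> h * u \<in> adjoin I f"
    by (auto simp: socle_nonzero_def)
  from u(3)[OF g] obtain p v where v: "g * u = p + v * f" "p \<in> I" "v \<in> A" by (metis adjoinE)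
  have "v \<notin> adjoin I g"
  proof
    assume "v \<in> adjoin I g"
    then obtain q w where qw: "v = q + w * g" "q \<in> I" "w \<in> A" by (metis adjoinE)
    have "g * (u - w * f) = p + f * q" using v qw by (simp add: algebra_simps)
    also have "\<dots> \<in> I" using I v qw fA by (auto intro: ideal_add ideal_mult)
    finally have "u - w * f \<in> I" using ng u qw fA by (auto simp: nzd_mod_def)
    from adjoinI[OF this qw(3), of f] u(2) show False by simp
  qed
  moreover have "h * v \<in> adjoin I g" if h: "h \<in> m" for h
  proof -
    have hA: "h \<in> A" using h m by auto
    from u(3)[OF h] obtain q w where qw: "h * u = q + w * f" "q \<in> I" "w \<in> A" by (metis adjoinE)
    have "g * (h * u) = h * (g * u)" by (simp add: algebra_simps)
    then have "f * (h * v - w * g) = g * q - h * p" using v qw by (simp add: algebra_simps)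
    also have "\<dots> \<in> I" using I v qw gA hA by (auto intro: ideal_diff ideal_mult)
    finally have "h * v - w * g \<in> I" using nf hA v qw gA by (auto simp: nzd_mod_def)
    from adjoinI[OF this qw(3), of g] show ?thesis by simp
  qed
  ultimately show ?thesis using v(3) by (auto simp: socle_nonzero_def)
qed

section \<open>Zero divisors in Noetherian rings\<close>

definition colon :: "'a set \<Rightarrow> 'a \<Rightarrow> 'a set" where
  "colon I u = {a \<in> A. a * u \<in> I}"

lemma is_ideal_colon:
  assumes "is_ideal I" "u \<in> A" shows "is_ideal (colon I u)"
  using assms by (intro is_idealI) (auto simp: colon_def distrib_right mult.assoc ideal_zero intro: ideal_add ideal_mult)

definition is_prime :: "'a set \<Rightarrow> bool" where
  "is_prime P \<longleftrightarrow> is_ideal P \<and> 1 \<notin> P \<and> (\<forall>a\<in>A. \<forall>b\<in>A. a * b \<in> P \<longrightarrow> a \<in> P \<or> b \<in> P)"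

lemma prime_ideals_witness:
  assumes "finite F" and "is_prime P" and "\<And>J. J \<in> F \<Longrightarrow> is_ideal J \<and> \<not> J \<subseteq> P"
  shows "\<exists>w\<in>A. w \<notin> P \<and> (\<forall>J\<in>F. w \<in> J)"
  using assms(1,3)
proof (induction F rule: finite_induct)
  case empty
  then show ?case using assms(2) by (intro bexI[of _ 1]) (auto simp: is_prime_def)
next
  case (insert J F)
  then obtain w where w: "w \<in> A" "w \<notin> P" "\<forall>J\<in>F. w \<in> J" by auto
  obtain b where b: "b \<in> J" "b \<notin> P" using insert.prems by blast
  have bA: "b \<in> A" using b insert.prems ideal_carrier by blast
  show ?case
  proof (intro bexI conjI)
    show "b * w \<notin> P" using assms(2) b w bA by (auto simp: is_prime_def)
    show "\<forall>J\<in>insert J F. b * w \<in> J"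
      using insert.prems b w bA by (auto intro: ideal_mult ideal_mult_right)
  qed (use bA w in auto)
qed

text \<open>
  The usual induction needs the removed prime to contain none of the others, so a minimal one is removed.
  If \<open>z\<close> avoids the others but lies in \<open>P\<close>, it is corrected by some \<open>w\<close> in \<open>m\<close> and in all the others, but
  outside \<open>P\<close>.
\<close>

lemma prime_avoidance:
  assumes "finite F" and m: "is_ideal m" and "\<And>P. P \<in> F \<Longrightarrow> is_prime P \<and> \<not> m \<subseteq> P"
  shows "\<exists>z\<in>m. \<forall>P\<in>F. z \<notin> P"
  using assms(1,3)
proof (induction F rule: finite_psubset_induct)
  case (psubset F)
  show ?case
  proof (cases "F = {}")
    case True
    then show ?thesis using ideal_zero[OF m] by auto
  next
    case False
    then obtain P where P: "P \<in> F" and min: "\<And>Q. Q \<in> F \<Longrightarrow> Q \<subseteq> P \<Longrightarrow> Q = P"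
      using finite_has_minimal[OF psubset.hyps(1)] by metis
    have "F - {P} \<subset> F" using P by auto
    from psubset.IH[OF this] psubset.prems obtain z where z: "z \<in> m" "\<forall>Q\<in>F - {P}. z \<notin> Q" by blast
    show ?thesis
    proof (cases "z \<in> P")
      case False
      then show ?thesis using z by auto
    next
      case True
      have pr: "is_prime P" using psubset.prems P by auto
      have "\<exists>w\<in>A. w \<notin> P \<and> (\<forall>J\<in>insert m (F - {P}). w \<in> J)"
        using psubset.hyps(1) pr by (rule_tac prime_ideals_witness)
          (use min m psubset.prems P in \<open>auto simp: is_prime_def\<close>)
      then obtain w where w: "w \<in> A" "w \<notin> P" "w \<in> m" "\<forall>Q\<in>F - {P}. w \<in> Q" by auto
      have "z + w \<notin> Q" if Q: "Q \<in> F" for Q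
      proof -
        have "is_ideal Q" using psubset.prems Q by (auto simp: is_prime_def)
        then show ?thesis
          using ideal_diff_iff[of Q "z + w" z] ideal_diff_iff[of Q "z + w" w] z w True Q by (cases "Q = P") auto
      qed
      then show ?thesis using z w ideal_add[OF m] by blast
    qed
  qed
qed

text \<open>
  The maximum condition, stated for arbitrary nonempty families of ideals. It is applied to indexed
  families, so \<open>noetherianE\<close> returns an index.
\<close>

definition noetherian :: bool where
  "noetherian \<longleftrightarrow> (\<forall>F. F \<noteq> {} \<longrightarrow> (\<forall>I\<in>F. is_ideal I) \<longrightarrow> (\<exists>I\<in>F. \<forall>J\<in>F. I \<subseteq> J \<longrightarrow> J = I))"

lemma noetherianE:
  assumes noetherian "X \<noteq> {}" "\<And>x. x \<in> X \<Longrightarrow> is_ideal (h x)"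
  obtains x where "x \<in> X" "\<And>y. y \<in> X \<Longrightarrow> h x \<subseteq> h y \<Longrightarrow> h y = h x"
proof -
  have "h ` X \<noteq> {}" "\<forall>I\<in>h ` X. is_ideal I" using assms by auto
  from assms(1)[unfolded noetherian_def, rule_format, OF this(1) this(2)[rule_format]]
  obtain I where "I \<in> h ` X" "\<And>J. J \<in> h ` X \<Longrightarrow> I \<subseteq> J \<Longrightarrow> J = I" by auto
  then show ?thesis using that by (metis imageE imageI)
qed

text \<open>
  The elements \<open>u\<close> whose annihilator \<open>(I : u)\<close> is maximal among annihilators of nonzero elements of \<open>A/I\<close>.
  These annihilators are the associated primes that are maximal under inclusion.
\<close>

definition maximal_annihilators :: "'a set \<Rightarrow> 'a set" where
  "maximal_annihilators I = {u \<in> A. u \<notin> I \<and> (\<forall>w\<in>A. w \<notin> I \<longrightarrow> colon I u \<subseteq> colon I w \<longrightarrow> colon I w = colon I u)}"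

lemma maximal_annihilator_prime:
  assumes I: "is_ideal I" and u: "u \<in> maximal_annihilators I"
  shows "is_prime (colon I u)"
  unfolding is_prime_def
proof (intro conjI ballI impI)
  have uA: "u \<in> A" "u \<notin> I"
    and max: "\<And>w. w \<in> A \<Longrightarrow> w \<notin> I \<Longrightarrow> colon I u \<subseteq> colon I w \<Longrightarrow> colon I w = colon I u"
    using u by (auto simp: maximal_annihilators_def)
  show "is_ideal (colon I u)" using is_ideal_colon[OF I] uA by auto
  show "1 \<notin> colon I u" using uA by (simp add: colon_def)
  fix a b assume a: "a \<in> A" and b: "b \<in> A" and ab: "a * b \<in> colon I u"
  show "a \<in> colon I u \<or> b \<in> colon I u"
  proof (cases "b * u \<in> I")
    case True
    then show ?thesis using b by (simp add: colon_def)
  next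
    case False
    have "colon I u \<subseteq> colon I (b * u)"
      using b ideal_mult[OF I b] by (auto simp: colon_def mult.left_commute[of _ b])
    then have "colon I (b * u) = colon I u" using max[of "b * u"] False b uA by auto
    moreover have "a \<in> colon I (b * u)" using ab a by (simp add: colon_def mult.assoc)
    ultimately show ?thesis by auto
  qed
qed

text \<open>
  Finitely many maximal annihilators cover all zero divisors modulo \<open>I\<close>. By the maximum condition a zero
  divisor \<open>f\<close> with \<open>f p \<in> I\<close> lies in a maximal annihilator, so only finiteness is at stake. The double
  annihilators \<open>N F\<close> of finite sets \<open>F\<close> of such \<open>u\<close> are ideals growing with \<open>F\<close>; a maximal one contains every
  \<open>u\<close>, which says that \<open>(I : u)\<close> contains the intersection of the \<open>(I : v)\<close> with \<open>v \<in> F\<close>. As \<open>(I : u)\<close> is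
  prime, it contains one of them, and the two agree by maximality.
\<close>

lemma zero_divisor_primes:
  assumes noeth: noetherian and I: "is_ideal I"
  obtains F where "finite F" "F \<subseteq> maximal_annihilators I"
    "\<And>f. f \<in> A \<Longrightarrow> (\<And>u. u \<in> F \<Longrightarrow> f \<notin> colon I u) \<Longrightarrow> nzd_mod I f"
proof -
  define U where "U = maximal_annihilators I"
  have UA: "u \<in> A" "u \<notin> I" if "u \<in> U" for u using that by (auto simp: U_def maximal_annihilators_def)
  define N where "N F = {w \<in> A. \<forall>a\<in>A. (\<forall>u\<in>F. a * u \<in> I) \<longrightarrow> a * w \<in> I}" for F
  have "is_ideal (N F)" for F
    using ideal_zero[OF I] ideal_add[OF I] ideal_mult[OF I]
    by (intro is_idealI) (auto simp: N_def distrib_left mult.left_commute)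
  then obtain F where F: "F \<in> {F. finite F \<and> F \<subseteq> U}"
    and max: "\<And>G. G \<in> {F. finite F \<and> F \<subseteq> U} \<Longrightarrow> N F \<subseteq> N G \<Longrightarrow> N G = N F"
    using noetherianE[OF noeth, of "{F. finite F \<and> F \<subseteq> U}" N]
    by (metis (no_types, lifting) empty_iff empty_subsetI finite.emptyI mem_Collect_eq)
  have inN: "u \<in> N F" if u: "u \<in> U" for u
  proof -
    have "N F \<subseteq> N (insert u F)" by (auto simp: N_def)
    then have "N (insert u F) = N F" using max F u by auto
    moreover have "u \<in> N (insert u F)" using UA[OF u] by (auto simp: N_def)
    ultimately show ?thesis by auto
  qed
  have "nzd_mod I f" if f: "f \<in> A" and nF: "\<And>u. u \<in> F \<Longrightarrow> f \<notin> colon I u" for f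
    unfolding nzd_mod_def
  proof (intro ballI impI, rule ccontr)
    fix p assume p: "p \<in> A" "f * p \<in> I" "p \<notin> I"
    let ?X = "{w \<in> A. w \<notin> I \<and> colon I p \<subseteq> colon I w}"
    have "p \<in> ?X" using p by auto
    then have "?X \<noteq> {}" by blast
    then obtain u where u: "u \<in> ?X" and umax: "\<And>w. w \<in> ?X \<Longrightarrow> colon I u \<subseteq> colon I w \<Longrightarrow> colon I w = colon I u"
      by (rule noetherianE[OF noeth, of ?X "colon I"]) (use is_ideal_colon[OF I] in auto)
    have uU: "u \<in> U" using u umax by (auto simp: U_def maximal_annihilators_def)
    have "\<exists>v\<in>F. colon I v \<subseteq> colon I u"
    proof (rule ccontr)
      assume "\<not> ?thesis"
      then have "\<exists>a\<in>A. a \<notin> colon I u \<and> (\<forall>J\<in>colon I ` F. a \<in> J)"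
        using F uU maximal_annihilator_prime[OF I, of u] is_ideal_colon[OF I] UA
        by (intro prime_ideals_witness) (auto simp: U_def)
      then obtain a where "a \<in> A" "a \<notin> colon I u" "\<forall>v\<in>F. a \<in> colon I v" by auto
      with inN[OF uU] show False by (auto simp: N_def colon_def)
    qed
    then obtain v where v: "v \<in> F" "colon I v \<subseteq> colon I u" by auto
    then have "v \<in> U" using F by auto
    then have "colon I u = colon I v" using v u by (auto simp: U_def maximal_annihilators_def)
    moreover have "f \<in> colon I u" using u p f by (auto simp: colon_def)
    ultimately show False using nF[OF v(1)] by auto
  qed
  then show ?thesis using that[of F] F by (auto simp: U_def)
qed

text \<open>
  A finite family of ideals allows one element to serve several quotients at once, because the primes
  covering the zero divisors of each of them can be avoided simultaneously. None of these primes contains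
  \<open>m\<close>: an inclusion \<open>m \<subseteq> (I : u)\<close> would make \<open>u\<close> a socle element.
\<close>

lemma common_nonzerodivisor:
  assumes noeth: noetherian and m: "is_ideal m" and S: "finite S"
    and "\<And>I. I \<in> S \<Longrightarrow> is_ideal I \<and> \<not> socle_nonzero m I"
  shows "\<exists>z\<in>m. \<forall>I\<in>S. nzd_mod I z"
proof -
  have "\<exists>F. finite F \<and> F \<subseteq> maximal_annihilators I \<and>
      (\<forall>f\<in>A. (\<forall>u\<in>F. f \<notin> colon I u) \<longrightarrow> nzd_mod I f)" if "I \<in> S" for I
    using zero_divisor_primes[OF noeth, of I] assms(4)[OF that] by metis
  then obtain F where F: "\<And>I. I \<in> S \<Longrightarrow> finite (F I)" "\<And>I. I \<in> S \<Longrightarrow> F I \<subseteq> maximal_annihilators I"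
      "\<And>I f. I \<in> S \<Longrightarrow> f \<in> A \<Longrightarrow> (\<forall>u\<in>F I. f \<notin> colon I u) \<Longrightarrow> nzd_mod I f"
    by metis
  have "\<exists>z\<in>m. \<forall>P\<in>(\<Union>I\<in>S. colon I ` F I). z \<notin> P"
  proof (rule prime_avoidance[OF _ m])
    show "finite (\<Union>I\<in>S. colon I ` F I)" using S F by auto
    fix P assume "P \<in> (\<Union>I\<in>S. colon I ` F I)"
    then obtain I u where I: "I \<in> S" and u: "u \<in> F I" and P: "P = colon I u" by auto
    have "u \<in> A" "u \<notin> I" using F(2)[OF I] u by (auto simp: maximal_annihilators_def)
    then have "\<not> m \<subseteq> P" using assms(4)[OF I] by (auto simp: socle_nonzero_def P colon_def)
    then show "is_prime P \<and> \<not> m \<subseteq> P"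
      using maximal_annihilator_prime[of I u] F(2)[OF I] u assms(4)[OF I] P by auto
  qed
  then obtain z where z: "z \<in> m" "\<And>I u. I \<in> S \<Longrightarrow> u \<in> F I \<Longrightarrow> z \<notin> colon I u" by auto
  then show ?thesis using F(3) ideal_carrier[OF m] by blast
qed

section \<open>All maximal regular sequences have the same length\<close>

lemma nzd_no_socle: "nzd_mod I f \<Longrightarrow> f \<in> m \<Longrightarrow> \<not> socle_nonzero m I"
  by (auto simp: nzd_mod_def socle_nonzero_def)

text \<open>
  The existential choice of the first element in \<open>reg_depth\<close> does not matter. For \<open>k = 0\<close> this is
  \<open>socle_nonzero_transfer\<close>. For larger \<open>k\<close> the elements \<open>f\<close> (given) and \<open>g\<close> (arbitrary) are compared
  through a third element \<open>z\<close>, regular modulo \<open>I\<close>, \<open>I + (f)\<close> and \<open>I + (g)\<close>. The induction hypothesis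
  replaces the second element of a sequence starting with \<open>f\<close> by \<open>z\<close>; the pair \<open>(f, z)\<close> becomes \<open>(z, f)\<close>;
  the induction hypothesis modulo \<open>I + (z)\<close> replaces \<open>f\<close> by \<open>g\<close>; and \<open>(z, g)\<close> becomes \<open>(g, z)\<close>.
\<close>

theorem reg_depth_adjoin:
  assumes noeth: noetherian and m: "is_ideal m" and I: "is_ideal I"
    and d: "reg_depth m (Suc k) I" and g: "g \<in> m" "nzd_mod I g"
  shows "reg_depth m k (adjoin I g)"
  using I d g
proof (induction k arbitrary: I g)
  case 0
  then show ?case using socle_nonzero_transfer[of I m _ g] ideal_carrier[OF m] by auto
next
  case (Suc k)
  have mA: "m \<subseteq> A" using ideal_carrier[OF m] by auto
  note I = \<open>is_ideal I\<close>
  from Suc.prems obtain f where f: "f \<in> m" "nzd_mod I f" and df: "reg_depth m (Suc k) (adjoin I f)" by auto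
  have A: "f \<in> A" "g \<in> A" using f Suc.prems mA by auto
  note If = is_ideal_adjoin[OF I A(1)] and Ig = is_ideal_adjoin[OF I A(2)]
  \<comment> \<open>Modulo \<open>I + (f)\<close> there is a regular element in \<open>m\<close>, so the socle is zero; the same must then hold
      modulo \<open>I + (g)\<close>, and a common \<open>z\<close> exists.\<close>
  have nf: "\<not> socle_nonzero m (adjoin I f)" using df nzd_no_socle by auto
  then have ng: "\<not> socle_nonzero m (adjoin I g)"
    using socle_nonzero_transfer[OF I mA] f Suc.prems by blast
  obtain z where z: "z \<in> m" "nzd_mod I z" "nzd_mod (adjoin I f) z" "nzd_mod (adjoin I g) z"
    using common_nonzerodivisor[OF noeth m, of "{I, adjoin I f, adjoin I g}"] I If Ig nf ng nzd_no_socle[OF f(2,1)]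
    by auto
  have zA: "z \<in> A" using z mA by auto
  note Iz = is_ideal_adjoin[OF I zA]
  have "reg_depth m k (adjoin (adjoin I f) z)" by (rule Suc.IH[OF If df z(1,3)])
  then have "reg_depth m k (adjoin (adjoin I z) f)" using adjoin_commute[OF I A(1) zA] by simp
  then have "reg_depth m (Suc k) (adjoin I z)"
    using nzd_swap[OF I A(1) zA f(2) z(3)] f(1) by auto
  from Suc.IH[OF Iz this _ nzd_swap[OF I A(2) zA _ z(4)]] Suc.prems
  have "reg_depth m k (adjoin (adjoin I z) g)" by blast
  then have "reg_depth m k (adjoin (adjoin I g) z)" using adjoin_commute[OF I A(2) zA] by simp
  then show ?case using z by auto
qed

definition adjoin_list :: "'a set \<Rightarrow> 'a list \<Rightarrow> 'a set" where
  "adjoin_list I fs = foldl adjoin I fs"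

lemma adjoin_list_simps [simp]:
  "adjoin_list I [] = I"
  "adjoin_list I (fs @ [f]) = adjoin (adjoin_list I fs) f"
  by (simp_all add: adjoin_list_def)

text \<open>
  Regular sequences without the condition that the final quotient be nonzero.
\<close>

definition weakly_regular :: "'a set \<Rightarrow> 'a list \<Rightarrow> bool" where
  "weakly_regular I fs \<longleftrightarrow> (\<forall>i<length fs. nzd_mod (adjoin_list I (take i fs)) (fs ! i))"

lemma weakly_regular_Nil [simp]: "weakly_regular I []"
  by (simp add: weakly_regular_def)

lemma weakly_regular_snoc [simp]:
  "weakly_regular I (fs @ [f]) \<longleftrightarrow> weakly_regular I fs \<and> nzd_mod (adjoin_list I fs) f"
  by (auto simp: weakly_regular_def nth_append less_Suc_eq)

lemma is_ideal_adjoin_list: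
  "is_ideal I \<Longrightarrow> set fs \<subseteq> A \<Longrightarrow> is_ideal (adjoin_list I fs)"
  by (induction fs rule: rev_induct) (simp_all add: is_ideal_adjoin)

lemma adjoin_list_superset: "I \<subseteq> adjoin_list I fs"
  by (induction fs rule: rev_induct) (use adjoin_superset in auto)

lemma adjoin_list_mem: "is_ideal I \<Longrightarrow> set fs \<subseteq> A \<Longrightarrow> f \<in> set fs \<Longrightarrow> f \<in> adjoin_list I fs"
  by (induction fs rule: rev_induct) (use adjoin_superset adjoin_self is_ideal_adjoin_list in auto)

lemma adjoin_list_least: "is_ideal J \<Longrightarrow> I \<subseteq> J \<Longrightarrow> set fs \<subseteq> J \<Longrightarrow> adjoin_list I fs \<subseteq> J"
  by (induction fs rule: rev_induct) (simp_all add: adjoin_least)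

lemma reg_depth_adjoin_list:
  assumes noeth: noetherian and m: "is_ideal m" and I: "is_ideal I" and d: "reg_depth m n I"
    and "weakly_regular I fs" "set fs \<subseteq> m" "length fs \<le> n"
  shows "reg_depth m (n - length fs) (adjoin_list I fs)"
  using assms(5-)
proof (induction fs rule: rev_induct)
  case Nil
  then show ?case using d by simp
next
  case (snoc f fs)
  have "set fs \<subseteq> A" using snoc.prems ideal_carrier[OF m] by auto
  moreover have "reg_depth m (Suc (n - Suc (length fs))) (adjoin_list I fs)"
    using snoc by (simp add: Suc_diff_Suc)
  ultimately show ?case using reg_depth_adjoin[OF noeth m is_ideal_adjoin_list[OF I], of fs _ f] snoc.prems by simp
qed

lemma reg_depth_imp_proper: "is_ideal I \<Longrightarrow> m \<subseteq> A \<Longrightarrow> reg_depth m n I \<Longrightarrow> I \<noteq> A"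
proof (induction n arbitrary: I)
  case 0
  then show ?case by (auto simp: socle_nonzero_def)
next
  case (Suc n)
  then obtain f where "f \<in> m" "reg_depth m n (adjoin I f)" by auto
  then have "adjoin I f \<noteq> A" "is_ideal (adjoin I f)" using Suc is_ideal_adjoin by blast+
  then show ?case using adjoin_superset[of I f] by (auto simp: is_ideal_def)
qed

text \<open>
  After \<open>n\<close> steps the socle is nonzero and no further element of \<open>m\<close> is regular; before that,
  \<open>reg_depth\<close> supplies a regular element.
\<close>

theorem maximal_regular_length:
  assumes noeth: noetherian and m: "is_ideal m" and I: "is_ideal I" and d: "reg_depth m n I"
    and fs: "weakly_regular I fs" "set fs \<subseteq> m"
  shows "length fs \<le> n"
    and "adjoin_list I fs \<noteq> A"
    and "length fs < n \<Longrightarrow> \<exists>g\<in>m. weakly_regular I (fs @ [g])"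
proof -
  have mA: "m \<subseteq> A" using ideal_carrier[OF m] by auto
  show "length fs \<le> n"
  proof (rule ccontr)
    assume n: "\<not> length fs \<le> n"
    have "weakly_regular I (take n fs)" using fs n by (auto simp: weakly_regular_def min_def)
    then have "reg_depth m (n - length (take n fs)) (adjoin_list I (take n fs))"
      by (rule reg_depth_adjoin_list[OF noeth m I d]) (use fs n in \<open>auto dest: in_set_takeD\<close>)
    moreover have "n - length (take n fs) = 0" using n by simp
    ultimately have "socle_nonzero m (adjoin_list I (take n fs))" by simp
    moreover have "nzd_mod (adjoin_list I (take n fs)) (fs ! n)" using fs n by (auto simp: weakly_regular_def)
    moreover have "fs ! n \<in> m" using fs n by auto
    ultimately show False using nzd_no_socle by blast
  qed
  then have dd: "reg_depth m (n - length fs) (adjoin_list I fs)"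
    using reg_depth_adjoin_list[OF noeth m I d] fs by blast
  moreover have "is_ideal (adjoin_list I fs)" using is_ideal_adjoin_list[OF I] fs mA by blast
  ultimately show "adjoin_list I fs \<noteq> A" using reg_depth_imp_proper mA by blast
  show "\<exists>g\<in>m. weakly_regular I (fs @ [g])" if "length fs < n"
  proof -
    have "n - length fs = Suc (n - length fs - 1)" using that by simp
    with dd show ?thesis using fs by (metis reg_depth.simps(2) weakly_regular_snoc)
  qed
qed

end

section \<open>Polynomial rings are Noetherian\<close>

abbreviation polys :: "nat set \<Rightarrow> 'k::field mpoly set" where
  "polys V \<equiv> carrier (poly_ring V)"

lemma polys_iff: "p \<in> polys V \<longleftrightarrow> (\<forall>m\<in>Poly_Mapping.keys p. Poly_Mapping.keys m \<subseteq> V)"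
  by (auto simp: poly_ring_def indets_def)

lemma keys_add_nat: "Poly_Mapping.keys (m + m' :: nat \<Rightarrow>\<^sub>0 nat) = Poly_Mapping.keys m \<union> Poly_Mapping.keys m'"
  by (auto simp: in_keys_iff lookup_add)

interpretation polys: subring_ideals "polys V :: 'k::field mpoly set" for V
proof
  fix x y :: "'k mpoly"
  assume x: "x \<in> polys V" and y: "y \<in> polys V"
  show "x + y \<in> polys V" using x y Poly_Mapping.keys_add[of x y] by (force simp: polys_iff)
  show "x * y \<in> polys V" using x y keys_mult[of x y]  by (force simp: polys_iff keys_add_nat)
next
  fix x :: "'k mpoly"
  assume x: "x \<in> polys V"
  then show "- x \<in> polys V" by (auto simp: polys_iff in_keys_iff)
qed (auto simp: polys_iff)

lemma single_in_polys: "Poly_Mapping.keys m \<subseteq> V \<Longrightarrow> Poly_Mapping.single m c \<in> polys V"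
  by (simp add: polys_iff)

lemma lookup_monomial_mult:
  fixes p :: "'k::field mpoly"
  shows "Poly_Mapping.lookup (Poly_Mapping.single d c * p) (d + m) = c * Poly_Mapping.lookup p m"
proof -
  have "Poly_Mapping.lookup (Poly_Mapping.single d c * p) (d + m) =
     (\<Sum>l. (c when d = l) * (\<Sum>q. Poly_Mapping.lookup p q when d + m = l + q))"
    by (simp add: lookup_mult lookup_single)
  also have "\<dots> = (\<Sum>l. (c * (\<Sum>q. Poly_Mapping.lookup p q when d + m = l + q)) when d = l)"
    by (simp add: when_mult)
  also have "\<dots> = c * (\<Sum>q. Poly_Mapping.lookup p q when d + m = d + q)"
    by simp
  also have "\<dots> = c * Poly_Mapping.lookup p m"
    by simp
  finally show ?thesis .
qed

lemma keys_monomial_mult: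
  fixes p :: "'k::field mpoly"
  assumes "t \<in> Poly_Mapping.keys (Poly_Mapping.single d c * p)"
  obtains m where "t = d + m" "m \<in> Poly_Mapping.keys p"
  using assms keys_mult[of "Poly_Mapping.single d c" p] that by (auto split: if_splits)

text \<open>
  A decreasing sequence of naturals is constant from the point where it attains its minimum.
\<close>

lemma nat_seq_mono_subseq:
  fixes f :: "nat \<Rightarrow> nat"
  obtains s :: "nat \<Rightarrow> nat" where "strict_mono s" "mono (f \<circ> s)"
proof -
  obtain s where s: "strict_mono s" "monoseq (\<lambda>n. f (s n))" using seq_monosub[of f] by blast
  show ?thesis
  proof (cases "\<forall>m n. m \<le> n \<longrightarrow> f (s m) \<le> f (s n)")
    case True
    then show ?thesis using that[OF s(1)] by (auto simp: mono_def)
  next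
    case False
    then have dec: "f (s n) \<le> f (s m)" if "m \<le> n" for m n using s(2) that by (auto simp: monoseq_def)
    obtain N where N: "\<And>n. f (s N) \<le> f (s n)"
      using ex_has_least_nat[of "\<lambda>_. True" 0 "\<lambda>n. f (s n)"] by auto
    have "f (s (N + i)) = f (s N)" for i using N[of "N + i"] dec[of N "N + i"] by simp
    then have "mono (f \<circ> (\<lambda>i. s (N + i)))" by (simp add: mono_def)
    moreover have "strict_mono (\<lambda>i. s (N + i))" using s(1) by (auto simp: strict_mono_def)
    ultimately show ?thesis using that by blast
  qed
qed

lemma dickson:
  fixes m :: "nat \<Rightarrow> nat \<Rightarrow>\<^sub>0 nat"
  assumes V: "finite V" and m: "\<And>i. Poly_Mapping.keys (m i) \<subseteq> V"
  obtains i j d where "i < j" "m j = d + m i" "Poly_Mapping.keys d \<subseteq> V"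
proof -
  have "\<exists>s::nat \<Rightarrow> nat. strict_mono s \<and> (\<forall>v\<in>V. mono (\<lambda>i. Poly_Mapping.lookup (m (s i)) v))"
    using V
  proof (induction V rule: finite_induct)
    case empty
    show ?case by (auto intro: exI[of _ id] simp: strict_mono_def)
  next
    case (insert v V)
    then obtain s :: "nat \<Rightarrow> nat" where s: "strict_mono s" "\<forall>v\<in>V. mono (\<lambda>i. Poly_Mapping.lookup (m (s i)) v)" by blast
    obtain t :: "nat \<Rightarrow> nat" where t: "strict_mono t" "mono ((\<lambda>i. Poly_Mapping.lookup (m (s i)) v) \<circ> t)"
      by (rule nat_seq_mono_subseq)
    have "strict_mono (s \<circ> t)" using s t by (simp add: strict_mono_o)
    moreover have "mono (\<lambda>i. Poly_Mapping.lookup (m ((s \<circ> t) i)) w)" if "w \<in> insert v V" for w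
      using that s(2) t strict_mono_mono[OF t(1)] by (auto simp: mono_def)
    ultimately show ?case by blast
  qed
  then obtain s :: "nat \<Rightarrow> nat" where s: "strict_mono s" "\<And>v. v \<in> V \<Longrightarrow> mono (\<lambda>i. Poly_Mapping.lookup (m (s i)) v)" by blast
  have le: "Poly_Mapping.lookup (m (s 0)) v \<le> Poly_Mapping.lookup (m (s 1)) v" for v
  proof (cases "v \<in> V")
    case True
    then show ?thesis using s(2)[OF True] by (auto simp: mono_def)
  next
    case False
    then have "Poly_Mapping.lookup (m (s 0)) v = 0" using m[of "s 0"] by (meson in_keys_iff subsetD)
    then show ?thesis by simp
  qed
  show ?thesis
  proof (rule that)
    show "s 0 < s 1" using s(1) by (simp add: strict_mono_def)
    show "m (s 1) = (m (s 1) - m (s 0)) + m (s 0)"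
      by (rule poly_mapping_eqI) (simp add: lookup_add lookup_minus le del: One_nat_def)
    show "Poly_Mapping.keys (m (s 1) - m (s 0)) \<subseteq> V"
      using m[of "s 1"] by (force simp: in_keys_iff lookup_minus)
  qed
qed

lemma monomial_nonneg: "(0 :: nat \<Rightarrow>\<^sub>0 nat) \<le> d"
proof -
  have "\<not> d < 0" by transfer (simp add: less_fun_def)
  then show ?thesis by simp
qed

text \<open>
  The order on exponent vectors is lexicographic. By Dickson's lemma an infinite descent would contain
  a monomial dividing a later, hence smaller one, while multiples are never smaller.
\<close>

lemma wf_lex_monomials:
  assumes "finite V"
  shows "wf {(a, b :: nat \<Rightarrow>\<^sub>0 nat). a < b \<and> Poly_Mapping.keys a \<subseteq> V \<and> Poly_Mapping.keys b \<subseteq> V}"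
  unfolding wf_iff_no_infinite_down_chain
proof
  assume "\<exists>f. \<forall>i. (f (Suc i), f i) \<in> {(a, b :: nat \<Rightarrow>\<^sub>0 nat). a < b \<and> Poly_Mapping.keys a \<subseteq> V \<and> Poly_Mapping.keys b \<subseteq> V}"
  then obtain f :: "nat \<Rightarrow> nat \<Rightarrow>\<^sub>0 nat" where f: "\<And>i. f (Suc i) < f i" "\<And>i. Poly_Mapping.keys (f i) \<subseteq> V" by auto
  obtain i j d where ij: "i < j" "f j = d + f i" using dickson[of V f] assms f(2) by metis
  have "f j < f i" using ij(1)
    by (induction j) (auto simp: less_Suc_eq intro: f(1) less_trans)
  moreover have "f i \<le> f j" using add_right_mono[OF monomial_nonneg[of d], of "f i"] ij by simp
  ultimately show False by simp
qed

text \<open>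
  Hilbert's basis theorem by leading monomials. In a strictly increasing chain of ideals, choose in each
  step a new element whose leading monomial is least possible. By Dickson's lemma some leading monomial
  divides a later one; subtracting the corresponding multiple leaves an element that is still new at the
  later step but has a smaller leading monomial.
\<close>

theorem polys_noetherian:
  assumes V: "finite V"
  shows "subring_ideals.noetherian (polys V :: 'k::field mpoly set)"
  unfolding polys.noetherian_def
proof (intro allI impI, rule ccontr)
  fix F :: "'k mpoly set set"
  assume F: "F \<noteq> {}" "\<forall>I\<in>F. polys.is_ideal V I" and "\<not> (\<exists>I\<in>F. \<forall>J\<in>F. I \<subseteq> J \<longrightarrow> J = I)"
  then have "\<exists>J. J \<in> F \<and> I \<subset> J" if "I \<in> F" for I using that by (metis psubsetI)
  then obtain G where G: "\<And>i. G i \<in> F" "\<And>i. G i \<subset> G (Suc i)"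
    using dependent_nat_choice[of "\<lambda>_ I. I \<in> F" "\<lambda>_ I J. I \<subset> J"] F(1) by (metis ex_in_conv)
  have mono: "G i \<subseteq> G j" if "i \<le> j" for i j
    using lift_Suc_mono_le[of G i j] G(2) that by blast
  have id: "polys.is_ideal V (G i)" for i using F(2) G(1) by auto
  define lm where "lm p = Max (Poly_Mapping.keys p)" for p :: "'k mpoly"
  have lm_key: "lm p \<in> Poly_Mapping.keys p" if "p \<noteq> 0" for p
    using that Max_in[of "Poly_Mapping.keys p"] poly_mapping_eqI[of p 0]
    by (auto simp: lm_def in_keys_iff)
  have lm_V: "Poly_Mapping.keys (lm p) \<subseteq> V" if "p \<noteq> 0" "p \<in> G i" for p i
    using lm_key[OF that(1)] polys.ideal_carrier[OF id that(2)] unfolding polys_iff by blast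
  let ?R = "{(a, b :: nat \<Rightarrow>\<^sub>0 nat). a < b \<and> Poly_Mapping.keys a \<subseteq> V \<and> Poly_Mapping.keys b \<subseteq> V}"
  have "\<exists>p. p \<in> G (Suc i) - G i \<and> (\<forall>q\<in>G (Suc i) - G i. \<not> lm q < lm p)" for i
  proof -
    have "lm ` (G (Suc i) - G i) \<noteq> {}" using G(2)[of i] by auto
    then obtain a where a: "a \<in> lm ` (G (Suc i) - G i)" "\<And>b. (b, a) \<in> ?R \<Longrightarrow> b \<notin> lm ` (G (Suc i) - G i)"
      using wf_lex_monomials[OF V] by (metis (no_types, lifting) wfE_min')
    have nz: "q \<noteq> 0" if "q \<in> G (Suc i) - G i" for q using polys.ideal_zero[OF id[of i]] that by auto
    from a(1) obtain p where p: "a = lm p" "p \<in> G (Suc i) - G i" by auto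
    have "\<not> lm q < lm p" if q: "q \<in> G (Suc i) - G i" for q
      using a(2)[of "lm q"] lm_V[OF nz[OF q], of "Suc i"] lm_V[OF nz[OF p(2)], of "Suc i"] p q by auto
    then show ?thesis using p by blast
  qed
  then obtain p where p: "\<And>i. p i \<in> G (Suc i)" "\<And>i. p i \<notin> G i"
    and least: "\<And>i q. q \<in> G (Suc i) \<Longrightarrow> q \<notin> G i \<Longrightarrow> \<not> lm q < lm (p i)" by (metis DiffE DiffI)
  have nz: "p i \<noteq> 0" for i using polys.ideal_zero[OF id[of i]] p(2)[of i] by auto
  obtain i j d where ij: "i < j" and d: "lm (p j) = d + lm (p i)" "Poly_Mapping.keys d \<subseteq> V"
    using dickson[of V "\<lambda>i. lm (p i)"] V lm_V[OF nz p(1)] by metis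
  define c where "c = Poly_Mapping.lookup (p j) (lm (p j)) / Poly_Mapping.lookup (p i) (lm (p i))"
  define r where "r = p j - Poly_Mapping.single d c * p i"
  have pi: "Poly_Mapping.single d c * p i \<in> G j"
    using mono[of "Suc i" j] ij p(1)[of i] polys.ideal_mult[OF id single_in_polys[OF d(2)]] by auto
  have r1: "r \<in> G (Suc j)"
    unfolding r_def using polys.ideal_diff[OF id p(1)] pi mono[of j "Suc j"] by auto
  have r2: "r \<notin> G j"
    using polys.ideal_add[OF id _ pi, of r] p(2)[of j] by (auto simp: r_def)
  have rz: "r \<noteq> 0" using r2 polys.ideal_zero[OF id[of j]] by auto
  have "Poly_Mapping.lookup (p i) (lm (p i)) \<noteq> 0" using lm_key[OF nz[of i]] by (simp add: in_keys_iff)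
  then have "Poly_Mapping.lookup r (lm (p j)) = 0"
    unfolding r_def lookup_minus by (simp add: d(1) lookup_monomial_mult) (simp add: c_def d(1))
  then have "lm r \<noteq> lm (p j)" using lm_key[OF rz] by (auto simp: in_keys_iff)
  moreover have "t \<le> lm (p j)" if t: "t \<in> Poly_Mapping.keys r" for t
  proof (cases "t \<in> Poly_Mapping.keys (p j)")
    case True
    then show ?thesis by (simp add: lm_def)
  next
    case False
    then have "t \<in> Poly_Mapping.keys (Poly_Mapping.single d c * p i)"
      using t by (auto simp: r_def in_keys_iff lookup_minus)
    then obtain m where "t = d + m" "m \<in> Poly_Mapping.keys (p i)" by (rule keys_monomial_mult)
    then show ?thesis unfolding d(1) by (auto intro!: add_left_mono simp: lm_def)
  qed
  ultimately have "lm r < lm (p j)" using lm_key[OF rz] by (metis order_le_imp_less_or_eq)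
  then show False using least[OF r1 r2] by simp
qed

section \<open>Renaming variables\<close>

lemma poly_mapping_induct_add [case_names single add]:
  assumes single: "\<And>k c. P (Poly_Mapping.single k c)" and add: "\<And>p q. P p \<Longrightarrow> P q \<Longrightarrow> P (p + q)"
  shows "P (p :: 'a \<Rightarrow>\<^sub>0 'b::comm_monoid_add)"
proof (induction p rule: update_induct)
  case const
  show ?case using single[of undefined 0] by simp
next
  case (update p k c)
  then have "Poly_Mapping.update k c p = p + Poly_Mapping.single k c"
    by (intro poly_mapping_eqI) (auto simp: lookup_update lookup_add lookup_single in_keys_iff when_def)
  then show ?case using add[OF update(3) single[of k c]] by simp
qed

text \<open>
  Used twice: on exponent vectors, where \<open>r\<close> renames variables and exponents of identified variables are
  added, and on polynomials, where \<open>r\<close> is the induced map of monomials.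
\<close>

definition pushforward :: "('a \<Rightarrow> 'b) \<Rightarrow> ('a \<Rightarrow>\<^sub>0 'c) \<Rightarrow> ('b \<Rightarrow>\<^sub>0 'c::comm_monoid_add)" where
  "pushforward r p = (\<Sum>i\<in>Poly_Mapping.keys p. Poly_Mapping.single (r i) (Poly_Mapping.lookup p i))"

lemma pushforward_superset:
  assumes "finite S" "Poly_Mapping.keys p \<subseteq> S"
  shows "pushforward r p = (\<Sum>i\<in>S. Poly_Mapping.single (r i) (Poly_Mapping.lookup p i))"
  unfolding pushforward_def by (rule sum.mono_neutral_left) (use assms in \<open>auto simp: in_keys_iff\<close>)

lemma pushforward_add: "pushforward r (p + q) = pushforward r p + pushforward r q"
proof -
  let ?S = "Poly_Mapping.keys p \<union> Poly_Mapping.keys q"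
  have "Poly_Mapping.keys (p + q) \<subseteq> ?S" by (rule Poly_Mapping.keys_add)
  then show ?thesis
    by (subst (1 2 3) pushforward_superset[of ?S]) (auto simp: lookup_add single_add sum.distrib)
qed

lemma pushforward_single [simp]: "pushforward r (Poly_Mapping.single k c) = Poly_Mapping.single (r k) c"
  by (cases "c = 0") (simp_all add: pushforward_def)

lemma keys_pushforward: "Poly_Mapping.keys (pushforward r p) \<subseteq> r ` Poly_Mapping.keys p"
proof -
  have "Poly_Mapping.keys (pushforward r p) \<subseteq>
      (\<Union>i\<in>Poly_Mapping.keys p. Poly_Mapping.keys (Poly_Mapping.single (r i) (Poly_Mapping.lookup p i)))"
    unfolding pushforward_def
    by (rule Poly_Mapping.keys_sum)
  then show ?thesis by auto
qed

definition rename :: "(nat \<Rightarrow> nat) \<Rightarrow> 'k::field mpoly \<Rightarrow> 'k mpoly" where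
  "rename r = pushforward (pushforward r)"

lemma rename_add: "rename r (p + q) = rename r p + rename r q"
  by (simp add: rename_def pushforward_add)

lemma rename_diff: "rename r (p - q) = rename r p - rename r q"
  using rename_add[of r "p - q" q] by simp

lemma rename_single [simp]:
  "rename r (Poly_Mapping.single m c) = Poly_Mapping.single (pushforward r m) c"
  by (simp add: rename_def)

lemma rename_mult: "rename r (p * q) = rename r p * rename r q"
proof (induction p rule: poly_mapping_induct_add)
  case (single k c)
  show ?case
    by (induction q rule: poly_mapping_induct_add)
      (simp_all add: mult_single pushforward_add rename_add distrib_left)
next
  case (add p p')
  then show ?case by (simp add: distrib_right rename_add)
qed

lemma rename_pvar [simp]: "rename r (pvar i) = pvar (r i)"
  by (simp add: pvar_def)

lemma rename_zero [simp]: "rename r 0 = 0"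
  by (simp add: rename_def pushforward_def)

lemma rename_one [simp]: "rename r 1 = 1"
  using rename_single[of r 0 1] by (simp add: pushforward_def flip: single_one)

lemma rename_prod: "rename r (\<Prod>i\<in>S. f i) = (\<Prod>i\<in>S. rename r (f i))"
  by (induction S rule: infinite_finite_induct) (simp_all add: rename_mult)

lemma pvar_in_polys [simp]: "i \<in> V \<Longrightarrow> pvar i \<in> polys V"
  by (simp add: pvar_def single_in_polys)

lemma rename_in_polys:
  assumes p: "p \<in> polys V" and r: "r ` V \<subseteq> V"
  shows "rename r p \<in> polys V"
  unfolding polys_iff
proof
  fix m assume "m \<in> Poly_Mapping.keys (rename r p)"
  then obtain m' where m: "m = pushforward r m'" "m' \<in> Poly_Mapping.keys p"
    using keys_pushforward[of "pushforward r" p] by (auto simp: rename_def)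
  then have "Poly_Mapping.keys m' \<subseteq> V" using p by (simp add: polys_iff)
  then show "Poly_Mapping.keys m \<subseteq> V" using keys_pushforward[of r m'] r m by blast
qed

lemma polys_sum_monomials: "(p :: 'k::field mpoly) = (\<Sum>m\<in>Poly_Mapping.keys p. Poly_Mapping.single m (Poly_Mapping.lookup p m))"
  by (rule poly_mapping_eqI)
    (auto simp: lookup_sum lookup_single when_def in_keys_iff sum.delta)

text \<open>
  Renaming is a ring endomorphism. Its congruence to the identity modulo \<open>I\<close> is multiplicative, so it is
  enough to have it for the variables.
\<close>

lemma rename_congruent:
  fixes p :: "'k::field mpoly"
  assumes I: "polys.is_ideal V I" and p: "p \<in> polys V" and r: "r ` V \<subseteq> V"
    and var: "\<And>i. i \<in> V \<Longrightarrow> pvar i - pvar (r i) \<in> I"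
  shows "p - rename r p \<in> I"
proof -
  have prod: "a * b - a' * b' \<in> I" if "a - a' \<in> I" "b - b' \<in> I" "b \<in> polys V" "a' \<in> polys V" for a b a' b'
  proof -
    have "a * b - a' * b' = b * (a - a') + a' * (b - b')" by (simp add: algebra_simps)
    then show ?thesis using that polys.ideal_add[OF I] polys.ideal_mult[OF I] by metis
  qed
  have mon: "Poly_Mapping.single m 1 - rename r (Poly_Mapping.single m 1) \<in> I" if "Poly_Mapping.keys m \<subseteq> V" for m
    using that
  proof (induction m rule: poly_mapping_induct_add)
    case (single i e)
    show ?case
    proof (cases "e = 0")
      case True
      then show ?thesis using polys.ideal_zero[OF I] by simp
    next
      case False
      then have i: "i \<in> V" using single by simp
      show ?thesis
      proof (induction e)
        case 0
        then show ?case using polys.ideal_zero[OF I] by simp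
      next
        case (Suc e)
        have eq: "Poly_Mapping.single (Poly_Mapping.single i (Suc e)) 1 =
            (pvar i :: 'k mpoly) * Poly_Mapping.single (Poly_Mapping.single i e) 1"
          by (simp add: pvar_def mult_single flip: single_add)
        have "Poly_Mapping.single (Poly_Mapping.single i e) 1 \<in> polys V"
          by (rule single_in_polys) (use i in simp)
        moreover have "rename r (pvar i :: 'k mpoly) \<in> polys V" using r i by auto
        ultimately show ?case unfolding eq rename_mult by (intro prod Suc) (use i var in auto)
      qed
    qed
  next
    case (add m m')
    have eq: "Poly_Mapping.single (m + m') (1 :: 'k) = Poly_Mapping.single m 1 * Poly_Mapping.single m' 1"
      by (simp add: mult_single)
    have "rename r (Poly_Mapping.single m (1 :: 'k)) \<in> polys V" "Poly_Mapping.single m' (1 :: 'k) \<in> polys V"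
      using add.prems by (auto simp: keys_add_nat intro!: rename_in_polys[OF _ r] single_in_polys simp del: rename_single)
    then show ?case unfolding eq rename_mult using add by (intro prod) (auto simp: keys_add_nat)
  qed
  have mon': "Poly_Mapping.single m c - rename r (Poly_Mapping.single m c) \<in> I"
    if "Poly_Mapping.keys m \<subseteq> V" for m c
  proof -
    have "Poly_Mapping.single m c - rename r (Poly_Mapping.single m c) =
      Poly_Mapping.single 0 c * (Poly_Mapping.single m 1 - rename r (Poly_Mapping.single m 1))"
      by (simp add: mult_single right_diff_distrib)
    then show ?thesis using polys.ideal_mult[OF I single_in_polys mon[OF that], of 0 c] by simp
  qed
  have sum: "rename r (sum f S) = (\<Sum>m\<in>S. rename r (f m))" for f :: "(nat \<Rightarrow>\<^sub>0 nat) \<Rightarrow> 'k mpoly" and S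
    by (induction S rule: infinite_finite_induct) (simp_all add: rename_add)
  have "p - rename r p = (\<Sum>m\<in>Poly_Mapping.keys p. Poly_Mapping.single m (Poly_Mapping.lookup p m)
      - rename r (Poly_Mapping.single m (Poly_Mapping.lookup p m)))"
    by (subst (1 2) polys_sum_monomials) (simp only: sum sum_subtractf)
  also have "\<dots> \<in> I"
    by (rule polys.ideal_sum[OF I], rule mon') (use p in \<open>auto simp: polys_iff\<close>)
  finally show ?thesis .
qed

section \<open>Monomial ideals\<close>

lemma monomial_span_in_ideal:
  fixes p :: "'k::field mpoly"
  assumes I: "polys.is_ideal V I" and p: "p \<in> polys V"
    and "\<And>m. m \<in> Poly_Mapping.keys p \<Longrightarrow> \<exists>t. Poly_Mapping.single t 1 \<in> I \<and> (\<forall>i. Poly_Mapping.lookup t i \<le> Poly_Mapping.lookup m i)"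
  shows "p \<in> I"
proof -
  have "Poly_Mapping.single m c \<in> I" if m: "m \<in> Poly_Mapping.keys p" for m c
  proof -
    obtain t where t: "Poly_Mapping.single t 1 \<in> I" "\<And>i. Poly_Mapping.lookup t i \<le> Poly_Mapping.lookup m i"
      using assms(3)[OF m] by blast
    have "m = (m - t) + t" by (rule poly_mapping_eqI) (simp add: lookup_add lookup_minus t)
    then have eq: "Poly_Mapping.single m c = Poly_Mapping.single (m - t) c * Poly_Mapping.single t 1"
      by (simp add: mult_single)
    have "Poly_Mapping.keys (m - t) \<subseteq> Poly_Mapping.keys m" by (auto simp: in_keys_iff lookup_minus)
    then have "Poly_Mapping.keys (m - t) \<subseteq> V" using p m by (auto simp: polys_iff)
    from polys.ideal_mult[OF I single_in_polys[OF this] t(1)] show ?thesis unfolding eq .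
  qed
  then show ?thesis by (subst polys_sum_monomials) (intro polys.ideal_sum[OF I])
qed

lemma lookup_monomial_mult_zero:
  fixes p :: "'k::field mpoly"
  assumes "Poly_Mapping.lookup m i < Poly_Mapping.lookup d i"
  shows "Poly_Mapping.lookup (Poly_Mapping.single d c * p) m = 0"
proof (rule ccontr)
  assume "\<not> ?thesis"
  then have "m \<in> Poly_Mapping.keys (Poly_Mapping.single d c * p)" by (simp add: in_keys_iff)
  then obtain m' where "m = d + m'" by (rule keys_monomial_mult)
  then show False using assms by (simp add: lookup_add)
qed

text \<open>
  The polynomials whose monomials all lie in \<open>T\<close> form a monomial ideal when \<open>T\<close> is closed under multiples.
  The conditions on \<open>T\<close> say that \<open>x\<^sub>a x\<^sub>b\<close> lies in that ideal, that no generator is divisible by the square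
  of \<open>x\<^sub>a\<close>, and that \<open>x\<^sub>b\<close> occurs only in multiples of \<open>x\<^sub>a x\<^sub>b\<close>. Then no cancellation happens in
  \<open>(x\<^sub>a - x\<^sub>b) p\<close> at the decisive places: if \<open>x\<^sub>a\<close> does not divide a monomial \<open>m\<close> of \<open>p\<close>, then \<open>x\<^sub>b m\<close> can
  only come from \<open>m\<close>; otherwise \<open>x\<^sub>b\<close> does not divide \<open>m\<close> and \<open>x\<^sub>a m\<close> can only come from \<open>m\<close>.
\<close>

lemma variable_difference_nonzerodivisor:
  fixes p :: "'k::field mpoly"
  assumes ab: "a \<noteq> b"
    and xy: "\<And>m. 1 \<le> Poly_Mapping.lookup m a \<Longrightarrow> 1 \<le> Poly_Mapping.lookup m b \<Longrightarrow> m \<in> T"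
    and x: "\<And>m. Poly_Mapping.single a 1 + m \<in> T \<Longrightarrow> 1 \<le> Poly_Mapping.lookup m a \<Longrightarrow> m \<in> T"
    and y: "\<And>m. Poly_Mapping.single b 1 + m \<in> T \<Longrightarrow> Poly_Mapping.lookup m a = 0 \<Longrightarrow> m \<in> T"
    and p: "Poly_Mapping.keys ((pvar a - pvar b) * p) \<subseteq> T"
  shows "Poly_Mapping.keys p \<subseteq> T"
proof (rule subsetI, rule ccontr)
  fix m assume m: "m \<in> Poly_Mapping.keys p" and mT: "m \<notin> T"
  have coeff: "Poly_Mapping.lookup ((pvar a - pvar b) * p) t =
      Poly_Mapping.lookup (Poly_Mapping.single (Poly_Mapping.single a 1) 1 * p) t -
      Poly_Mapping.lookup (Poly_Mapping.single (Poly_Mapping.single b 1) 1 * p) t" for t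
    by (simp add: pvar_def left_diff_distrib lookup_minus)
  show False
  proof (cases "Poly_Mapping.lookup m a = 0")
    case True
    have "Poly_Mapping.lookup (Poly_Mapping.single (Poly_Mapping.single a 1) 1 * p) (Poly_Mapping.single b 1 + m) = 0"
      by (rule lookup_monomial_mult_zero[of _ a]) (use ab True in \<open>simp add: lookup_add lookup_single\<close>)
    then have "Poly_Mapping.single b 1 + m \<in> Poly_Mapping.keys ((pvar a - pvar b) * p)"
      unfolding in_keys_iff coeff lookup_monomial_mult using m by (simp add: in_keys_iff)
    then show False using p y True mT by blast
  next
    case False
    then have "Poly_Mapping.lookup m b = 0" using xy[of m] mT by force
    then have "Poly_Mapping.lookup (Poly_Mapping.single (Poly_Mapping.single b 1) 1 * p) (Poly_Mapping.single a 1 + m) = 0"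
      by (intro lookup_monomial_mult_zero[of _ b]) (use ab in \<open>simp add: lookup_add lookup_single\<close>)
    then have "Poly_Mapping.single a 1 + m \<in> Poly_Mapping.keys ((pvar a - pvar b) * p)"
      unfolding in_keys_iff coeff lookup_monomial_mult using m by (simp add: in_keys_iff)
    then show False using p x False mT by force
  qed
qed

section \<open>Ideals of the polynomial ring\<close>

lemma cring_poly_ring: "cring (poly_ring V :: 'k::field mpoly ring)"
proof (rule cringI)
  let ?R = "poly_ring V :: 'k mpoly ring"
  have s: "add ?R = (+)" "mult ?R = (*)" "zero ?R = 0" "one ?R = 1" by (simp_all add: poly_ring_def)
  show "abelian_group ?R"
  proof (rule abelian_groupI)
    fix x assume "x \<in> carrier ?R"
    then show "\<exists>y\<in>carrier ?R. y \<oplus>\<^bsub>?R\<^esub> x = \<zero>\<^bsub>?R\<^esub>" by (intro bexI[of _ "- x"]) (simp_all add: s)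
  qed (simp_all add: s algebra_simps)
  show "comm_monoid ?R" by (rule comm_monoidI) (simp_all add: s algebra_simps)
qed (simp_all add: poly_ring_def algebra_simps)

lemma poly_ring_simps [simp]:
  "add (poly_ring V) = (+)" "mult (poly_ring V) = (*)" "zero (poly_ring V) = 0" "one (poly_ring V) = 1"
  by (simp_all add: poly_ring_def)

lemma poly_ring_ideal_iff: "ideal I (poly_ring V :: 'k::field mpoly ring) \<longleftrightarrow> polys.is_ideal V I"
proof
  interpret cring "poly_ring V :: 'k mpoly ring" by (rule cring_poly_ring)
  { assume "ideal I (poly_ring V)"
    then interpret ideal I "poly_ring V" .
    show "polys.is_ideal V I"
      using a_subset zero_closed a_closed I_l_closed by (intro polys.is_idealI) auto }
  { assume I: "polys.is_ideal V I"
    have neg: "\<ominus>\<^bsub>poly_ring V\<^esub> x = - x" if "x \<in> polys V" for x :: "'k mpoly"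
      using that minus_equality[of "- x" x] by simp
    show "ideal I (poly_ring V)"
    proof (rule idealI)
      show "subgroup I (add_monoid (poly_ring V))"
      proof (rule subgroup.intro)
        fix x assume "x \<in> I"
        then show "inv\<^bsub>add_monoid (poly_ring V)\<^esub> x \<in> I"
          using neg[of x] polys.ideal_carrier[OF I] polys.ideal_uminus[OF I] by (simp add: a_inv_def)
      qed (use I in \<open>auto simp: polys.is_ideal_def\<close>)
      fix a x :: "'k mpoly" assume "a \<in> I" "x \<in> polys V"
      then show "x \<otimes>\<^bsub>poly_ring V\<^esub> a \<in> I" "a \<otimes>\<^bsub>poly_ring V\<^esub> x \<in> I"
        using polys.ideal_mult[OF I] polys.ideal_mult_right[OF I] by auto
    qed (rule ring_axioms) }
qed

lemma genideal_poly_ring: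
  assumes "S \<subseteq> polys V"
  shows "polys.is_ideal V (Idl\<^bsub>poly_ring V\<^esub> S)" and "S \<subseteq> Idl\<^bsub>poly_ring V\<^esub> S"
    and "\<And>J. polys.is_ideal V J \<Longrightarrow> S \<subseteq> J \<Longrightarrow> Idl\<^bsub>poly_ring V\<^esub> S \<subseteq> (J :: 'k::field mpoly set)"
proof -
  interpret cring "poly_ring V :: 'k mpoly ring" by (rule cring_poly_ring)
  show "polys.is_ideal V (Idl\<^bsub>poly_ring V\<^esub> S)"
    using genideal_ideal[OF assms] by (simp add: poly_ring_ideal_iff)
  show "S \<subseteq> Idl\<^bsub>poly_ring V\<^esub> S" by (rule genideal_self[OF assms])
  show "Idl\<^bsub>poly_ring V\<^esub> S \<subseteq> J" if "polys.is_ideal V J" "S \<subseteq> J" for J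
    using genideal_minimal that by (simp add: poly_ring_ideal_iff)
qed

section \<open>A regular sequence for the Helm graph\<close>

lemma closed_neighborhood_hub: "n \<ge> 1 \<Longrightarrow> closed_neighborhood (helm_edges n) 0 = {0..n}"
  by (auto simp: closed_neighborhood_def helm_edges_def cycle_edges_def doubleton_eq_iff)

lemma closed_neighborhood_pendant:
  "1 \<le> j \<Longrightarrow> j \<le> n \<Longrightarrow> closed_neighborhood (helm_edges n) (n + j) = {j, n + j}"
  by (auto simp: closed_neighborhood_def helm_edges_def cycle_edges_def doubleton_eq_iff)

lemma closed_neighborhood_rim:
  "1 \<le> j \<Longrightarrow> j \<le> n \<Longrightarrow> {j, n + j} \<subseteq> closed_neighborhood (helm_edges n) j"
  by (auto simp: closed_neighborhood_def helm_edges_def)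

lemma closed_neighborhood_helm_subset: "n \<ge> 1 \<Longrightarrow> i \<in> helm_vertices n \<Longrightarrow> closed_neighborhood (helm_edges n) i \<subseteq> helm_vertices n"
  by (auto simp: closed_neighborhood_def helm_edges_def cycle_edges_def helm_vertices_def doubleton_eq_iff)

lemma prod_pvar_in_polys: "S \<subseteq> V \<Longrightarrow> (\<Prod>j\<in>S. pvar j) \<in> polys V"
  by (induction S rule: infinite_finite_induct) auto

text \<open>
  The neighborhood of a rim vertex contains that of its pendant vertex, so its product is redundant and the
  ideal is generated by the spokes \<open>x\<^sub>j x\<^sub>n\<^sub>+\<^sub>j\<close> and the hub product \<open>x\<^sub>0 \<cdots> x\<^sub>n\<close>.
\<close>

lemma helm_CNI_least:
  assumes n: "n \<ge> 1" and J: "polys.is_ideal (helm_vertices n) (J :: 'k::field mpoly set)"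
    and spokes: "\<And>j. 1 \<le> j \<Longrightarrow> j \<le> n \<Longrightarrow> pvar j * pvar (n + j) \<in> J"
    and hub: "(\<Prod>j\<in>{0..n}. pvar j) \<in> J"
  shows "CNI (helm_vertices n) (helm_edges n) \<subseteq> J"
  unfolding CNI_def
proof (rule genideal_poly_ring(3)[OF _ J])
  let ?N = "closed_neighborhood (helm_edges n)"
  show "(\<lambda>i. \<Prod>j\<in>?N i. pvar j) ` helm_vertices n \<subseteq> polys (helm_vertices n)"
    using prod_pvar_in_polys closed_neighborhood_helm_subset[OF n] by blast
  have "(\<Prod>j\<in>?N i. pvar j) \<in> J" if i: "i \<in> helm_vertices n" for i
  proof -
    have pendant: "(\<Prod>j\<in>?N i. pvar j) \<in> J" if j: "1 \<le> j" "j \<le> n" "{j, n + j} \<subseteq> ?N i" for j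
    proof -
      have fin: "finite (?N i)"
        using closed_neighborhood_helm_subset[OF n i] by (rule finite_subset) (simp add: helm_vertices_def)
      have "(\<Prod>l\<in>?N i. pvar l) = (\<Prod>l\<in>?N i - {j, n + j}. pvar l) * (\<Prod>l\<in>{j, n + j}. pvar l :: 'k mpoly)"
        using fin j by (intro prod.subset_diff) auto
      also have "(\<Prod>l\<in>{j, n + j}. pvar l) = (pvar j * pvar (n + j) :: 'k mpoly)" using n by simp
      finally have eq: "(\<Prod>l\<in>?N i. pvar l) = (\<Prod>l\<in>?N i - {j, n + j}. pvar l) * (pvar j * pvar (n + j) :: 'k mpoly)" .
      show ?thesis unfolding eq
        by (rule polys.ideal_mult[OF J prod_pvar_in_polys spokes])
          (use closed_neighborhood_helm_subset[OF n i] j in auto)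
    qed
    consider "i = 0" | "1 \<le> i" "i \<le> n" | j where "i = n + j" "1 \<le> j" "j \<le> n"
    proof (cases "i \<le> n")
      case False
      then have "i = n + (i - n)" "1 \<le> i - n" "i - n \<le> n" using i by (auto simp: helm_vertices_def)
      then show ?thesis using that(3) by blast
    qed (use that in fastforce)
    then show ?thesis
    proof cases
      case 1
      then show ?thesis using hub closed_neighborhood_hub[OF n] by simp
    next
      case 2
      then show ?thesis using pendant[of i] closed_neighborhood_rim by simp
    next
      case 3
      then show ?thesis using pendant[of j] closed_neighborhood_pendant[of j n] by simp
    qed
  qed
  then show "(\<lambda>i. \<Prod>j\<in>?N i. pvar j) ` helm_vertices n \<subseteq> J" by blast
qed

lemma helm_CNI_mem:
  assumes n: "n \<ge> 1"
  defines "L \<equiv> CNI (helm_vertices n) (helm_edges n) :: 'k::field mpoly set"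
  shows "polys.is_ideal (helm_vertices n) L"
    and "\<And>j. 1 \<le> j \<Longrightarrow> j \<le> n \<Longrightarrow> pvar j * pvar (n + j) \<in> L"
    and "(\<Prod>j\<in>{0..n}. pvar j) \<in> L"
proof -
  let ?N = "closed_neighborhood (helm_edges n)"
  have gens: "(\<lambda>i. \<Prod>j\<in>?N i. pvar j :: 'k mpoly) ` helm_vertices n \<subseteq> polys (helm_vertices n)"
    using prod_pvar_in_polys closed_neighborhood_helm_subset[OF n] by blast
  show "polys.is_ideal (helm_vertices n) L"
    unfolding L_def CNI_def by (rule genideal_poly_ring(1)[OF gens])
  have mem: "(\<Prod>j\<in>?N i. pvar j) \<in> L" if "i \<in> helm_vertices n" for i
    using genideal_poly_ring(2)[OF gens] that unfolding L_def CNI_def by blast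
  show "pvar j * pvar (n + j) \<in> L" if "1 \<le> j" "j \<le> n" for j
    using mem[of "n + j"] closed_neighborhood_pendant[OF that] that n by (simp add: helm_vertices_def)
  show "(\<Prod>j\<in>{0..n}. pvar j) \<in> L"
    using mem[of 0] closed_neighborhood_hub[OF n] by (simp add: helm_vertices_def)
qed

text \<open>
  Identify the first \<open>k\<close> pendant vertices with their rim vertices. Modulo the first \<open>k\<close> elements of the
  regular sequence this renaming is the identity.
\<close>

definition fold_pendants :: "nat \<Rightarrow> nat \<Rightarrow> nat \<Rightarrow> nat" where
  "fold_pendants n k i = (if n < i \<and> i \<le> n + k then i - n else i)"

text \<open>
  The monomials in the ideal \<open>L\<close> becomes after this identification: the first \<open>k\<close> spokes turn into squares
  \<open>x\<^sub>j\<^sup>2\<close>, the other spokes and the hub product survive.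
\<close>

definition folded_monomials :: "nat \<Rightarrow> nat \<Rightarrow> (nat \<Rightarrow>\<^sub>0 nat) set" where
  "folded_monomials n k = {m.
     (\<exists>j. 1 \<le> j \<and> j \<le> k \<and> 2 \<le> Poly_Mapping.lookup m j) \<or>
     (\<exists>j. k < j \<and> j \<le> n \<and> 1 \<le> Poly_Mapping.lookup m j \<and> 1 \<le> Poly_Mapping.lookup m (n + j)) \<or>
     (\<forall>i\<le>n. 1 \<le> Poly_Mapping.lookup m i)}"

lemma folded_monomials_add: "m \<in> folded_monomials n k \<Longrightarrow> d + m \<in> folded_monomials n k"
  unfolding folded_monomials_def by (auto simp: lookup_add intro: trans_le_add2)

lemma prod_pvar:
  "finite S \<Longrightarrow> (\<Prod>j\<in>S. pvar j :: 'k::field mpoly) = Poly_Mapping.single (\<Sum>j\<in>S. Poly_Mapping.single j 1) 1"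
  by (induction S rule: finite_induct) (simp_all add: pvar_def mult_single flip: single_one)

lemma lookup_squarefree: "finite S \<Longrightarrow> Poly_Mapping.lookup (\<Sum>j\<in>S. Poly_Mapping.single j 1) i = (if i \<in> S then 1 else 0 :: nat)"
  by (simp add: lookup_sum lookup_single when_def)

definition helm_regular :: "nat \<Rightarrow> nat \<Rightarrow> 'k::field mpoly list" where
  "helm_regular n k = map (\<lambda>j. pvar j - pvar (n + j)) [1..<k + 1]"

lemma helm_regular_Suc: "helm_regular n (Suc k) = helm_regular n k @ [pvar (Suc k) - pvar (n + Suc k)]"
  by (simp add: helm_regular_def)

lemma helm_regular_mem: "p \<in> set (helm_regular n k) \<longleftrightarrow> (\<exists>j. 1 \<le> j \<and> j \<le> k \<and> p = pvar j - pvar (n + j))"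
  by (auto simp: helm_regular_def)

lemma helm_regular_polys: "k \<le> n \<Longrightarrow> set (helm_regular n k) \<subseteq> polys (helm_vertices n)"
  by (auto simp: helm_regular_mem helm_vertices_def intro!: polys.diff_mem pvar_in_polys)

lemma folded_preimage_ideal:
  assumes "k \<le> n"
  shows "polys.is_ideal V {p \<in> polys V. Poly_Mapping.keys (rename (fold_pendants n k) p :: 'k::field mpoly) \<subseteq> folded_monomials n k}"
proof (rule polys.is_idealI)
  fix x y :: "'k mpoly"
  assume "x \<in> {p \<in> polys V. Poly_Mapping.keys (rename (fold_pendants n k) p) \<subseteq> folded_monomials n k}"
    "y \<in> {p \<in> polys V. Poly_Mapping.keys (rename (fold_pendants n k) p) \<subseteq> folded_monomials n k}"
  then show "x + y \<in> {p \<in> polys V. Poly_Mapping.keys (rename (fold_pendants n k) p) \<subseteq> folded_monomials n k}"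
    using Poly_Mapping.keys_add[of "rename (fold_pendants n k) x" "rename (fold_pendants n k) y"]
    by (auto simp: rename_add)
next
  fix a x :: "'k mpoly"
  assume "a \<in> polys V" "x \<in> {p \<in> polys V. Poly_Mapping.keys (rename (fold_pendants n k) p) \<subseteq> folded_monomials n k}"
  then show "a * x \<in> {p \<in> polys V. Poly_Mapping.keys (rename (fold_pendants n k) p) \<subseteq> folded_monomials n k}"
    using keys_mult[of "rename (fold_pendants n k) a" "rename (fold_pendants n k) x"]
    by (auto simp: rename_mult intro: folded_monomials_add dest!: subsetD)
qed auto

text \<open>
  \<open>A / (L + (x\<^sub>1 - x\<^sub>n\<^sub>+\<^sub>1, \<dots>, x\<^sub>k - x\<^sub>n\<^sub>+\<^sub>k))\<close> is the quotient of a smaller polynomial ring by a monomial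
  ideal. Stated through the renaming, it turns membership into a condition on monomials without changing the
  ring. Forwards, the right-hand side defines an ideal containing all generators. Backwards, \<open>p\<close> is congruent to
  its renaming, and the monomials listed lie in the ideal; the squares do since
  \<open>x\<^sub>j\<^sup>2 = x\<^sub>j (x\<^sub>j - x\<^sub>n\<^sub>+\<^sub>j) + x\<^sub>j x\<^sub>n\<^sub>+\<^sub>j\<close>.
\<close>

lemma helm_adjoin_iff:
  fixes p :: "'k::field mpoly"
  assumes n: "n \<ge> 1" and k: "k \<le> n" and p: "p \<in> polys (helm_vertices n)"
  defines "L \<equiv> CNI (helm_vertices n) (helm_edges n) :: 'k mpoly set"
  shows "p \<in> polys.adjoin_list (helm_vertices n) L (helm_regular n k) \<longleftrightarrow>
    Poly_Mapping.keys (rename (fold_pendants n k) p) \<subseteq> folded_monomials n k"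
proof
  let ?V = "helm_vertices n" and ?r = "fold_pendants n k"
  define J where "J = {p \<in> polys ?V. Poly_Mapping.keys (rename ?r p :: 'k mpoly) \<subseteq> folded_monomials n k}"
  have J: "polys.is_ideal ?V J" unfolding J_def by (rule folded_preimage_ideal[OF k])
  have L: "polys.is_ideal ?V L" unfolding L_def by (rule helm_CNI_mem(1)[OF n])
  define Lk where "Lk = polys.adjoin_list ?V L (helm_regular n k)"
  have Lk: "polys.is_ideal ?V Lk" unfolding Lk_def
    by (rule polys.is_ideal_adjoin_list[OF L helm_regular_polys[OF k]])
  have r: "?r ` ?V \<subseteq> ?V" using k by (auto simp: fold_pendants_def helm_vertices_def)
  have V: "j \<le> n \<Longrightarrow> j \<in> ?V" "j \<le> n \<Longrightarrow> n + j \<in> ?V" for j by (auto simp: helm_vertices_def)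
  have "L \<subseteq> J" unfolding L_def
  proof (rule helm_CNI_least[OF n J])
    fix j assume j: "1 \<le> j" "j \<le> n"
    have "rename ?r (pvar j * pvar (n + j)) = (pvar j * pvar (?r (n + j)) :: 'k mpoly)"
      using j by (simp add: rename_mult fold_pendants_def)
    also have "\<dots> = Poly_Mapping.single (Poly_Mapping.single j 1 + Poly_Mapping.single (?r (n + j)) 1) 1"
      by (simp add: pvar_def mult_single)
    also have "Poly_Mapping.keys \<dots> \<subseteq> folded_monomials n k"
    proof (cases "j \<le> k")
      case True
      then show ?thesis using j by (auto simp: folded_monomials_def fold_pendants_def lookup_add)
    next
      case False
      then have "k < j \<and> j \<le> n" "?r (n + j) = n + j" using j by (auto simp: fold_pendants_def)
      then show ?thesis by (auto simp: folded_monomials_def lookup_add intro!: exI[of _ j])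
    qed
    finally show "pvar j * pvar (n + j) \<in> J" using V j by (simp add: J_def)
  next
    have "rename ?r (\<Prod>j\<in>{0..n}. pvar j) = (\<Prod>j\<in>{0..n}. pvar j :: 'k mpoly)"
      unfolding rename_prod by (rule prod.cong) (auto simp: fold_pendants_def)
    moreover have "Poly_Mapping.keys (\<Prod>j\<in>{0..n}. pvar j :: 'k mpoly) \<subseteq> folded_monomials n k"
      by (simp add: prod_pvar folded_monomials_def lookup_squarefree del: One_nat_def)
    moreover have "(\<Prod>j\<in>{0..n}. pvar j :: 'k mpoly) \<in> polys ?V" by (rule prod_pvar_in_polys) (use V in auto)
    ultimately show "(\<Prod>j\<in>{0..n}. pvar j) \<in> J" by (simp add: J_def)
  qed
  moreover have "set (helm_regular n k) \<subseteq> J"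
  proof
    fix f :: "'k mpoly" assume "f \<in> set (helm_regular n k)"
    then obtain j where j: "1 \<le> j" "j \<le> k" "f = pvar j - pvar (n + j)" by (auto simp: helm_regular_mem)
    have "rename ?r f = 0" using j k by (simp add: rename_diff fold_pendants_def)
    moreover have "f \<in> polys ?V" unfolding j(3) using j k V by (intro polys.diff_mem pvar_in_polys) auto
    ultimately show "f \<in> J" by (simp add: J_def)
  qed
  ultimately have "Lk \<subseteq> J" unfolding Lk_def by (rule polys.adjoin_list_least[OF J])
  then show "Poly_Mapping.keys (rename ?r p) \<subseteq> folded_monomials n k" if "p \<in> polys.adjoin_list ?V L (helm_regular n k)"
    using that by (auto simp: J_def Lk_def)
  have dif: "pvar j - pvar (n + j) \<in> Lk" if "1 \<le> j" "j \<le> k" for j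
    unfolding Lk_def using that
    by (intro polys.adjoin_list_mem[OF L helm_regular_polys[OF k]]) (auto simp: helm_regular_mem)
  have LLk: "L \<subseteq> Lk" unfolding Lk_def by (rule polys.adjoin_list_superset)
  have spoke: "pvar j * pvar (n + j) \<in> Lk" if "1 \<le> j" "j \<le> n" for j
    using helm_CNI_mem(2)[OF n that] LLk unfolding L_def by blast
  have "pvar i - pvar (?r i) \<in> Lk" if "i \<in> ?V" for i
  proof (cases "n < i \<and> i \<le> n + k")
    case True
    then obtain j where j: "i = n + j" "1 \<le> j" "j \<le> k" by (metis Suc_leI add_le_cancel_left less_add_same_cancel1 less_imp_add_positive One_nat_def)
    then have "pvar i - pvar (?r i) = - (pvar j - pvar (n + j) :: 'k mpoly)" by (simp add: fold_pendants_def)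
    then show ?thesis using polys.ideal_uminus[OF Lk dif[OF j(2,3)]] by simp
  next
    case False
    then show ?thesis using polys.ideal_zero[OF Lk] by (auto simp: fold_pendants_def)
  qed
  then have cong: "p - rename ?r p \<in> Lk" using rename_congruent[OF Lk p r] by blast
  have rp: "rename ?r p \<in> Lk" if "Poly_Mapping.keys (rename ?r p) \<subseteq> folded_monomials n k"
  proof (rule monomial_span_in_ideal[OF Lk rename_in_polys[OF p r]])
    fix m assume "m \<in> Poly_Mapping.keys (rename ?r p)"
    then have "m \<in> folded_monomials n k" using that by auto
    then consider (sq) j where "1 \<le> j" "j \<le> k" "2 \<le> Poly_Mapping.lookup m j"
      | (sp) j where "k < j" "j \<le> n" "1 \<le> Poly_Mapping.lookup m j" "1 \<le> Poly_Mapping.lookup m (n + j)"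
      | (hub) "\<forall>i\<le>n. 1 \<le> Poly_Mapping.lookup m i"
      unfolding folded_monomials_def by auto
    then show "\<exists>t. Poly_Mapping.single t 1 \<in> Lk \<and> (\<forall>i. Poly_Mapping.lookup t i \<le> Poly_Mapping.lookup m i)"
    proof cases
      case sq
      have "pvar j * pvar (n + j) \<in> Lk" using spoke sq k by simp
      moreover have "pvar j * (pvar j - pvar (n + j)) \<in> Lk"
        using polys.ideal_mult[OF Lk pvar_in_polys dif] V sq k by simp
      ultimately have "pvar j * (pvar j - pvar (n + j)) + pvar j * pvar (n + j) \<in> Lk"
        using polys.ideal_add[OF Lk] by blast
      then have "pvar j * pvar j \<in> Lk" by (simp add: algebra_simps)
      then have "Poly_Mapping.single (Poly_Mapping.single j 1 + Poly_Mapping.single j 1) 1 \<in> Lk"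
        by (simp add: pvar_def mult_single)
      then show ?thesis using sq
        by (intro exI[of _ "Poly_Mapping.single j 1 + Poly_Mapping.single j 1"]) (auto simp: lookup_add lookup_single when_def)
    next
      case sp
      have "pvar j * pvar (n + j) \<in> Lk" using spoke sp by simp
      then have "Poly_Mapping.single (Poly_Mapping.single j 1 + Poly_Mapping.single (n + j) 1) 1 \<in> Lk"
        by (simp add: pvar_def mult_single)
      then show ?thesis using sp n
        by (intro exI[of _ "Poly_Mapping.single j 1 + Poly_Mapping.single (n + j) 1"]) (auto simp: lookup_add lookup_single when_def)
    next
      case hub
      have "(\<Prod>j\<in>{0..n}. pvar j) \<in> Lk" using helm_CNI_mem(3)[OF n] LLk unfolding L_def by auto
      then have "Poly_Mapping.single (\<Sum>j\<in>{0..n}. Poly_Mapping.single j 1) 1 \<in> Lk" by (simp add: prod_pvar)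
      then show ?thesis using hub
        by (intro exI[of _ "\<Sum>j\<in>{0..n}. Poly_Mapping.single j 1"]) (auto simp: lookup_squarefree simp del: One_nat_def)
    qed
  qed
  show "p \<in> polys.adjoin_list ?V L (helm_regular n k)" if "Poly_Mapping.keys (rename ?r p) \<subseteq> folded_monomials n k"
    using polys.ideal_diff_iff[OF Lk cong] rp[OF that] by (simp add: Lk_def)
qed

text \<open>
  Renaming the first \<open>k\<close> pendant vertices fixes the next two variables, so the difference stays a difference of
  variables, and the renamed monomial ideal meets the conditions of \<open>variable_difference_nonzerodivisor\<close>.
\<close>

lemma helm_regular_nonzerodivisor:
  assumes n: "n \<ge> 1" and k: "k < n"
  defines "L \<equiv> CNI (helm_vertices n) (helm_edges n) :: 'k::field mpoly set"
  shows "polys.nzd_mod (helm_vertices n) (polys.adjoin_list (helm_vertices n) L (helm_regular n k))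
    (pvar (Suc k) - pvar (n + Suc k))"
  unfolding polys.nzd_mod_def
proof (intro ballI impI)
  fix p :: "'k mpoly"
  let ?V = "helm_vertices n" and ?r = "fold_pendants n k" and ?g = "pvar (Suc k) - pvar (n + Suc k) :: 'k mpoly"
  assume p: "p \<in> polys ?V" and gp: "?g * p \<in> polys.adjoin_list ?V L (helm_regular n k)"
  have "?g \<in> polys ?V" using k by (intro polys.diff_mem pvar_in_polys) (auto simp: helm_vertices_def)
  then have "Poly_Mapping.keys (rename ?r (?g * p)) \<subseteq> folded_monomials n k"
    using helm_adjoin_iff[OF n, of k "?g * p"] gp p k by (simp add: L_def)
  moreover have "rename ?r ?g = ?g" using k by (simp add: rename_diff fold_pendants_def)
  ultimately have *: "Poly_Mapping.keys (?g * rename ?r p) \<subseteq> folded_monomials n k" by (simp add: rename_mult)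
  have "Poly_Mapping.keys (rename ?r p) \<subseteq> folded_monomials n k"
  proof (rule variable_difference_nonzerodivisor[OF _ _ _ _ *])
    fix m assume m: "Poly_Mapping.single (Suc k) 1 + m \<in> folded_monomials n k" "1 \<le> Poly_Mapping.lookup m (Suc k)"
    let ?xm = "Poly_Mapping.single (Suc k) 1 + m"
    have eq: "Poly_Mapping.lookup ?xm i = Poly_Mapping.lookup m i" if "i \<noteq> Suc k" for i
      using that by (simp add: lookup_add lookup_single)
    then have pos: "1 \<le> Poly_Mapping.lookup m i" if "1 \<le> Poly_Mapping.lookup ?xm i" for i
      using that m(2) by (cases "i = Suc k") auto
    have "j \<le> k \<Longrightarrow> Poly_Mapping.lookup ?xm j = Poly_Mapping.lookup m j" for j using eq by simp
    then show "m \<in> folded_monomials n k"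
      using m(1) pos unfolding folded_monomials_def mem_Collect_eq by metis
  next
    fix m assume m: "Poly_Mapping.single (n + Suc k) 1 + m \<in> folded_monomials n k" "Poly_Mapping.lookup m (Suc k) = 0"
    let ?ym = "Poly_Mapping.single (n + Suc k) 1 + m"
    have eq: "Poly_Mapping.lookup ?ym i = Poly_Mapping.lookup m i" if "i \<noteq> n + Suc k" for i
      using that by (simp add: lookup_add lookup_single)
    from m(1) consider (sq) j where "1 \<le> j" "j \<le> k" "2 \<le> Poly_Mapping.lookup ?ym j"
      | (sp) j where "k < j" "j \<le> n" "1 \<le> Poly_Mapping.lookup ?ym j" "1 \<le> Poly_Mapping.lookup ?ym (n + j)"
      | (hub) "\<forall>i\<le>n. 1 \<le> Poly_Mapping.lookup ?ym i"
      unfolding folded_monomials_def by blast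
    then show "m \<in> folded_monomials n k"
    proof cases
      case sq
      then show ?thesis using eq[of j] k by (auto simp: folded_monomials_def)
    next
      case sp
      have "1 \<le> Poly_Mapping.lookup m j" using sp eq[of j] by simp
      then have "j \<noteq> Suc k" using m(2) by auto
      then have "1 \<le> Poly_Mapping.lookup m (n + j)" using sp eq[of "n + j"] by simp
      then show ?thesis using sp \<open>1 \<le> Poly_Mapping.lookup m j\<close> by (auto simp: folded_monomials_def)
    next
      case hub
      then have "1 \<le> Poly_Mapping.lookup ?ym (Suc k)" using k by simp
      then show ?thesis using eq[of "Suc k"] m(2) n by simp
    qed
  qed (use k n in \<open>auto simp: folded_monomials_def\<close>)
  then show "p \<in> polys.adjoin_list ?V L (helm_regular n k)"
    using helm_adjoin_iff[OF n _ p, of k] k by (simp add: L_def)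
qed

text \<open>
  When all pendant vertices are identified with rim vertices, the quotient is
  \<open>K[x\<^sub>0, \<dots>, x\<^sub>n] / (x\<^sub>1\<^sup>2, \<dots>, x\<^sub>n\<^sup>2, x\<^sub>0 \<cdots> x\<^sub>n)\<close>. Its socle contains the class of \<open>x\<^sub>1 \<cdots> x\<^sub>n\<close>, which is
  nonzero because this product is squarefree and misses \<open>x\<^sub>0\<close>.
\<close>

lemma helm_socle:
  assumes n: "n \<ge> 1"
  defines "L \<equiv> CNI (helm_vertices n) (helm_edges n) :: 'k::field mpoly set"
  shows "polys.socle_nonzero (helm_vertices n) (graded_maximal_ideal (helm_vertices n))
    (polys.adjoin_list (helm_vertices n) L (helm_regular n n))"
proof -
  let ?V = "helm_vertices n" and ?r = "fold_pendants n n"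
  define u :: "'k mpoly" where "u = (\<Prod>j\<in>{1..n}. pvar j)"
  have L: "polys.is_ideal ?V L" unfolding L_def by (rule helm_CNI_mem(1)[OF n])
  have Ln: "polys.is_ideal ?V (polys.adjoin_list ?V L (helm_regular n n))"
    by (rule polys.is_ideal_adjoin_list[OF L helm_regular_polys]) simp
  have uV: "u \<in> polys ?V" unfolding u_def by (rule prod_pvar_in_polys) (auto simp: helm_vertices_def)
  have ru: "rename ?r u = u" unfolding u_def rename_prod
    by (rule prod.cong) (auto simp: fold_pendants_def)
  have us: "u = Poly_Mapping.single (\<Sum>j\<in>{1..n}. Poly_Mapping.single j 1) 1" unfolding u_def by (simp add: prod_pvar)
  have "u \<notin> polys.adjoin_list ?V L (helm_regular n n)"
    using helm_adjoin_iff[OF n _ uV, of n] unfolding ru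
    by (auto simp: L_def us folded_monomials_def lookup_squarefree simp del: One_nat_def)
  moreover have "g * u \<in> polys.adjoin_list ?V L (helm_regular n n)" if "g \<in> graded_maximal_ideal ?V" for g
  proof -
    let ?C = "polys.colon ?V (polys.adjoin_list ?V L (helm_regular n n)) u"
    have "pvar i \<in> ?C" if i: "i \<in> ?V" for i
    proof -
      have "rename ?r (pvar i * u) = Poly_Mapping.single (Poly_Mapping.single (?r i) 1 + (\<Sum>j\<in>{1..n}. Poly_Mapping.single j 1)) 1"
        unfolding rename_mult ru by (simp add: us pvar_def mult_single)
      also have "Poly_Mapping.keys \<dots> \<subseteq> folded_monomials n n"
      proof (cases "i = 0")
        case True
        then have "(1 :: nat) \<le> Poly_Mapping.lookup (Poly_Mapping.single (?r i) 1 + (\<Sum>j\<in>{1..n}. Poly_Mapping.single j 1)) l" if "l \<le> n" for l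
          using that by (simp add: lookup_squarefree lookup_add lookup_single fold_pendants_def when_def del: One_nat_def single_one)
        then show ?thesis by (simp add: folded_monomials_def)
      next
        case False
        then have "1 \<le> ?r i \<and> ?r i \<le> n" using i by (auto simp: fold_pendants_def helm_vertices_def)
        then show ?thesis
          by (simp add: folded_monomials_def lookup_squarefree lookup_add exI[of _ "?r i"] del: One_nat_def)
      qed
      finally show ?thesis
        using helm_adjoin_iff[OF n, of n "pvar i * u"] i uV by (simp add: polys.colon_def L_def)
    qed
    then have "graded_maximal_ideal ?V \<subseteq> ?C"
      unfolding graded_maximal_ideal_def
      by (intro genideal_poly_ring(3) polys.is_ideal_colon[OF Ln uV]) auto
    then show ?thesis using that by (auto simp: polys.colon_def)
  qed
  ultimately show ?thesis unfolding polys.socle_nonzero_def using uV by blast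
qed

text \<open>
  \<open>reg_depth\<close> unfolds from the last quotient back to the first, so the induction counts the elements of the
  sequence that have not been divided out yet.
\<close>

theorem helm_reg_depth:
  assumes n: "n \<ge> 1"
  defines "L \<equiv> CNI (helm_vertices n) (helm_edges n) :: 'k::field mpoly set"
  shows "polys.reg_depth (helm_vertices n) (graded_maximal_ideal (helm_vertices n)) n L"
proof -
  let ?V = "helm_vertices n" let ?m = "graded_maximal_ideal ?V :: 'k mpoly set"
  have vars: "pvar ` ?V \<subseteq> polys ?V" by auto
  have m: "polys.is_ideal ?V ?m" "pvar ` ?V \<subseteq> ?m"
    unfolding graded_maximal_ideal_def by (rule genideal_poly_ring[OF vars])+
  have "polys.reg_depth ?V ?m i (polys.adjoin_list ?V L (helm_regular n (n - i)))" if "i \<le> n" for i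
    using that
  proof (induction i)
    case 0
    then show ?case using helm_socle[OF n] by (simp add: L_def)
  next
    case (Suc i)
    define k where "k = n - Suc i"
    have k: "k < n" "n - i = Suc k" using Suc.prems by (auto simp: k_def)
    have "pvar (Suc k) - pvar (n + Suc k) \<in> ?m"
      using m(2) k by (intro polys.ideal_diff[OF m(1)]) (auto simp: helm_vertices_def)
    moreover note helm_regular_nonzerodivisor[OF n k(1)]
    ultimately show ?case
      using Suc k unfolding k_def[symmetric] polys.reg_depth.simps L_def by (auto simp: helm_regular_Suc)
  qed
  from this[of n] show ?thesis by (simp add: helm_regular_def)
qed

section \<open>Regular sequences on quotient modules\<close>

lemma quotient_module_simps:
  "carrier (quotient_module M N) = a_rcosets\<^bsub>M\<^esub> N"
  "zero (quotient_module M N) = N"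
  "add (quotient_module M N) = set_add M"
  "smult (quotient_module M N) a X = (\<Union>x\<in>X. N +>\<^bsub>M\<^esub> (a \<odot>\<^bsub>M\<^esub> x))"
  by (simp_all add: quotient_module_def ring.defs FactRing_def)

lemma abelian_group_cong:
  assumes "abelian_group F" and "carrier G = carrier F" "add G = add F" "zero G = zero F"
  shows "abelian_group G"
proof (rule abelian_groupI)
  interpret F: abelian_group F by fact
  fix x assume x: "x \<in> carrier G"
  then show "\<exists>y\<in>carrier G. y \<oplus>\<^bsub>G\<^esub> x = \<zero>\<^bsub>G\<^esub>"
    using assms F.l_neg[of x] by (intro bexI[of _ "\<ominus>\<^bsub>F\<^esub> x"]) simp_all
  fix y assume y: "y \<in> carrier G"
  show "x \<oplus>\<^bsub>G\<^esub> y = y \<oplus>\<^bsub>G\<^esub> x" using F.a_comm x y assms by simp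
  show "x \<oplus>\<^bsub>G\<^esub> y \<oplus>\<^bsub>G\<^esub> z = x \<oplus>\<^bsub>G\<^esub> (y \<oplus>\<^bsub>G\<^esub> z)" if "z \<in> carrier G" for z
    using F.a_assoc x y that assms by simp
  show "x \<oplus>\<^bsub>G\<^esub> y \<in> carrier G" using x y assms by simp
next
  interpret F: abelian_group F by fact
  show "\<zero>\<^bsub>G\<^esub> \<in> carrier G" using assms by simp
  show "\<zero>\<^bsub>G\<^esub> \<oplus>\<^bsub>G\<^esub> x = x" if "x \<in> carrier G" for x using that assms by simp
qed

text \<open>
  \<open>module\<close> admits extended records; here ring and module have exactly the record types on which
  quotient modules and the submodules \<open>(S)M\<close> are defined.
\<close>

locale plain_module = module R M
  for R :: "'a ring" (structure) and M :: "('a, 'b) module" (structure)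
begin

lemma submodule_abelian_subgroup:
  assumes "submodule N R M"
  shows "abelian_subgroup N M"
proof (rule abelian_subgroupI3)
  show "additive_subgroup N M" by (rule additive_subgroup.intro[OF submodule.axioms(1)[OF assms]])
  show "abelian_group M" ..
qed

lemma carrier_quotient_module: "carrier (quotient_module M N) = (\<lambda>x. N +>\<^bsub>M\<^esub> x) ` carrier M"
  by (auto simp: quotient_module_simps A_RCOSETS_def')

lemma quotient_module_smult:
  assumes N: "submodule N R M" and a: "a \<in> carrier R" and x: "x \<in> carrier M"
  shows "a \<odot>\<^bsub>quotient_module M N\<^esub> (N +>\<^bsub>M\<^esub> x) = N +>\<^bsub>M\<^esub> (a \<odot>\<^bsub>M\<^esub> x)"
proof -
  interpret N: abelian_subgroup N M by (rule submodule_abelian_subgroup[OF N])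
  have "N +>\<^bsub>M\<^esub> (a \<odot>\<^bsub>M\<^esub> y) = N +>\<^bsub>M\<^esub> (a \<odot>\<^bsub>M\<^esub> x)" if "y \<in> N +>\<^bsub>M\<^esub> x" for y
  proof -
    obtain h where h: "h \<in> N" "y = h \<oplus>\<^bsub>M\<^esub> x" using \<open>y \<in> N +>\<^bsub>M\<^esub> x\<close> by (auto simp: a_r_coset_def')
    have "a \<odot>\<^bsub>M\<^esub> y = a \<odot>\<^bsub>M\<^esub> h \<oplus>\<^bsub>M\<^esub> a \<odot>\<^bsub>M\<^esub> x" using h a x by (simp add: smult_r_distr)
    moreover have "a \<odot>\<^bsub>M\<^esub> h \<in> N" by (rule submodule.smult_closed[OF N a h(1)])
    ultimately have "a \<odot>\<^bsub>M\<^esub> y \<in> N +>\<^bsub>M\<^esub> (a \<odot>\<^bsub>M\<^esub> x)" by (auto simp: a_r_coset_def')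
    then show ?thesis using N.a_repr_independence' a x by (metis smult_closed)
  qed
  moreover have "x \<in> N +>\<^bsub>M\<^esub> x" by (rule N.a_rcos_self[OF x])
  ultimately show ?thesis unfolding quotient_module_simps by blast
qed

lemma coset_eq_submodule_iff:
  assumes N: "submodule N R M" and x: "x \<in> carrier M"
  shows "N +>\<^bsub>M\<^esub> x = N \<longleftrightarrow> x \<in> N"
proof -
  interpret N: abelian_subgroup N M by (rule submodule_abelian_subgroup[OF N])
  show ?thesis using N.a_rcos_self[OF x] N.a_rcos_const by auto
qed

lemma quotient_module_is_module:
  assumes N: "submodule N R M"
  shows "plain_module R (quotient_module M N)"
proof (intro plain_module.intro moduleI)
  interpret N: abelian_subgroup N M by (rule submodule_abelian_subgroup[OF N])
  let ?Q = "quotient_module M N"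
  have add: "(N +>\<^bsub>M\<^esub> x) \<oplus>\<^bsub>?Q\<^esub> (N +>\<^bsub>M\<^esub> y) = N +>\<^bsub>M\<^esub> (x \<oplus>\<^bsub>M\<^esub> y)"
    if "x \<in> carrier M" "y \<in> carrier M" for x y
    using that N.a_rcos_sum by (simp add: quotient_module_simps)
  note smult = quotient_module_smult[OF N]
  show "cring R" ..
  show "abelian_group ?Q"
  proof (rule abelian_group_cong)
    show "abelian_group (M Quot N)"
      by (rule comm_group_abelian_groupI)
        (simp add: FactRing_def N.a_factorgroup_is_comm_group[unfolded A_FactGroup_def'])
  qed (simp_all add: quotient_module_simps FactRing_def)
  fix a x assume a: "a \<in> carrier R" and "x \<in> carrier ?Q"
  then obtain x' where x: "x = N +>\<^bsub>M\<^esub> x'" "x' \<in> carrier M" by (auto simp: carrier_quotient_module)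
  show "a \<odot>\<^bsub>?Q\<^esub> x \<in> carrier ?Q" using a x by (auto simp: carrier_quotient_module smult)
  { fix b assume b: "b \<in> carrier R"
    show "(a \<oplus> b) \<odot>\<^bsub>?Q\<^esub> x = a \<odot>\<^bsub>?Q\<^esub> x \<oplus>\<^bsub>?Q\<^esub> b \<odot>\<^bsub>?Q\<^esub> x"
      using a b x by (simp add: smult add smult_l_distr)
    show "(a \<otimes> b) \<odot>\<^bsub>?Q\<^esub> x = a \<odot>\<^bsub>?Q\<^esub> (b \<odot>\<^bsub>?Q\<^esub> x)"
      using a b x by (simp add: smult smult_assoc1) }
  { fix y assume "y \<in> carrier ?Q"
    then obtain y' where y: "y = N +>\<^bsub>M\<^esub> y'" "y' \<in> carrier M" by (auto simp: carrier_quotient_module)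
    show "a \<odot>\<^bsub>?Q\<^esub> (x \<oplus>\<^bsub>?Q\<^esub> y) = a \<odot>\<^bsub>?Q\<^esub> x \<oplus>\<^bsub>?Q\<^esub> a \<odot>\<^bsub>?Q\<^esub> y"
      using a x y by (simp add: smult add smult_r_distr) }
next
  fix x assume "x \<in> carrier (quotient_module M N)"
  then show "\<one> \<odot>\<^bsub>quotient_module M N\<^esub> x = x"
    by (auto simp: carrier_quotient_module quotient_module_smult[OF N])
qed

lemma nonzerodivisor_on_quotient_iff:
  assumes N: "submodule N R M" and a: "a \<in> carrier R"
  shows "nonzerodivisor_on a (quotient_module M N) \<longleftrightarrow>
    (\<forall>x\<in>carrier M. a \<odot>\<^bsub>M\<^esub> x \<in> N \<longrightarrow> x \<in> N)"
  using a by (auto simp: nonzerodivisor_on_def carrier_quotient_module quotient_module_smult[OF N]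
      quotient_module_simps(2) coset_eq_submodule_iff[OF N])

lemma smult_submodule_is_submodule:
  assumes S: "S \<subseteq> carrier R"
  shows "submodule (smult_submodule R S M) R M"
proof -
  let ?F = "{N. submodule N R M \<and> (\<forall>a\<in>S. \<forall>x\<in>carrier M. a \<odot>\<^bsub>M\<^esub> x \<in> N)}"
  have "carrier M \<in> ?F" using carrier_is_submodule S by auto
  then have sub: "\<Inter>?F \<subseteq> carrier M" by blast
  show ?thesis unfolding smult_submodule_def
  proof (rule submoduleI[OF sub])
    show "\<zero>\<^bsub>M\<^esub> \<in> \<Inter>?F" using subgroup.one_closed[OF submodule.axioms(1)] by fastforce
    fix x assume x: "x \<in> \<Inter>?F"
    then show "\<ominus>\<^bsub>M\<^esub> x \<in> \<Inter>?F" using submoduleE(3) by blast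
    show "x \<oplus>\<^bsub>M\<^esub> y \<in> \<Inter>?F" if "y \<in> \<Inter>?F" for y using x that submoduleE(5) by blast
    show "a \<odot>\<^bsub>M\<^esub> x \<in> \<Inter>?F" if "a \<in> carrier R" for a using x that submoduleE(4) by blast
  qed
qed

end

lemma plain_module_self: "cring R \<Longrightarrow> plain_module R (self_module R)"
proof -
  fix R :: "'a ring" assume "cring R"
  then interpret cring R .
  have s: "carrier (self_module R) = carrier R" "add (self_module R) = add R"
    "zero (self_module R) = zero R" "smult (self_module R) = mult R"
    by (simp_all add: self_module_def ring.defs)
  show "plain_module R (self_module R)"
  proof (intro plain_module.intro moduleI)
    show "abelian_group (self_module R)"
      by (rule abelian_group_cong[of R]) (simp_all add: s abelian_group_axioms)
  qed (simp_all add: s is_cring l_distr r_distr m_assoc)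
qed

lemma self_module_poly_ring_simps [simp]:
  "carrier (self_module (poly_ring V)) = polys V" "add (self_module (poly_ring V)) = (+)"
  "zero (self_module (poly_ring V)) = 0" "smult (self_module (poly_ring V)) = (*)"
  by (simp_all add: self_module_def ring.defs)

lemma ideal_submodule:
  assumes I: "polys.is_ideal V (I :: 'k::field mpoly set)"
  shows "submodule I (poly_ring V) (self_module (poly_ring V))"
proof -
  interpret plain_module "poly_ring V :: 'k mpoly ring" "self_module (poly_ring V)"
    by (rule plain_module_self[OF cring_poly_ring])
  have neg: "\<ominus>\<^bsub>self_module (poly_ring V)\<^esub> x = - x" if "x \<in> polys V" for x :: "'k mpoly"
    using that M.minus_equality[of "- x" x] by simp
  show ?thesis
    using neg polys.ideal_carrier[OF I] polys.ideal_zero[OF I] polys.ideal_uminus[OF I]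
      polys.ideal_add[OF I] polys.ideal_mult[OF I]
    by (intro submoduleI) auto
qed

text \<open>
  The coset \<open>L + p\<close> in terms of the addition of the type.
\<close>

definition poly_coset :: "'k::field mpoly set \<Rightarrow> 'k mpoly \<Rightarrow> 'k mpoly set" where
  "poly_coset L p = (\<lambda>h. h + p) ` L"

lemma poly_coset_eq_iff:
  assumes L: "polys.is_ideal V (L :: 'k::field mpoly set)"
  shows "poly_coset L p = poly_coset L q \<longleftrightarrow> p - q \<in> L"
proof
  assume eq: "poly_coset L p = poly_coset L q"
  have "p \<in> poly_coset L p" using polys.ideal_zero[OF L] by (force simp: poly_coset_def)
  then show "p - q \<in> L" unfolding eq by (auto simp: poly_coset_def)
next
  have *: "poly_coset L p \<subseteq> poly_coset L q" if "p - q \<in> L" for p q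
  proof
    fix x assume "x \<in> poly_coset L p"
    then obtain h where h: "h \<in> L" "x = h + p" by (auto simp: poly_coset_def)
    then show "x \<in> poly_coset L q"
      using polys.ideal_add[OF L h(1) that] by (auto simp: poly_coset_def image_iff algebra_simps intro!: bexI[of _ "h + (p - q)"])
  qed
  assume "p - q \<in> L"
  then show "poly_coset L p = poly_coset L q"
    using *[of p q] *[of q p] polys.ideal_uminus[OF L, of "p - q"] by auto
qed

context
  fixes V :: "nat set" and L :: "'k::field mpoly set" and M
  assumes L: "polys.is_ideal V L"
  defines "M \<equiv> quotient_module (self_module (poly_ring V)) L"
begin

lemma quotient_poly_ring_module: "plain_module (poly_ring V) M"
  unfolding M_def
  by (rule plain_module.quotient_module_is_module[OF plain_module_self[OF cring_poly_ring] ideal_submodule[OF L]])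

lemma quotient_poly_ring_simps:
  "carrier M = poly_coset L ` polys V"
  "zero M = poly_coset L 0"
  "p \<in> polys V \<Longrightarrow> q \<in> polys V \<Longrightarrow> add M (poly_coset L p) (poly_coset L q) = poly_coset L (p + q)"
  "a \<in> polys V \<Longrightarrow> p \<in> polys V \<Longrightarrow> smult M a (poly_coset L p) = poly_coset L (a * p)"
proof -
  let ?A = "self_module (poly_ring V) :: ('k mpoly, 'k mpoly) module"
  interpret plain_module "poly_ring V :: 'k mpoly ring" ?A
    by (rule plain_module_self[OF cring_poly_ring])
  note sub = ideal_submodule[OF L]
  interpret L: abelian_subgroup L ?A by (rule submodule_abelian_subgroup[OF sub])
  have coset: "L +>\<^bsub>?A\<^esub> p = poly_coset L p" for p
    by (auto simp: a_r_coset_def' poly_coset_def)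
  show "carrier M = poly_coset L ` polys V"
    by (simp add: M_def carrier_quotient_module coset)
  show "zero M = poly_coset L 0" by (simp add: M_def quotient_module_simps poly_coset_def)
  show "add M (poly_coset L p) (poly_coset L q) = poly_coset L (p + q)" if "p \<in> polys V" "q \<in> polys V"
    using L.a_rcos_sum[of p q] that by (simp add: M_def quotient_module_simps coset)
  show "smult M a (poly_coset L p) = poly_coset L (a * p)" if "a \<in> polys V" "p \<in> polys V"
    using quotient_module_smult[OF sub, of a p] that by (simp add: M_def coset)
qed

text \<open>
  Submodules of \<open>A/L\<close> are the images of the ideals containing \<open>L\<close>. This is what brings iterated quotients
  of \<open>A/L\<close>, whose elements are cosets of cosets, back to ideals of \<open>A\<close>.
\<close>

lemma smult_submodule_quotient:
  assumes fs: "set fs \<subseteq> polys V"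
  shows "smult_submodule (poly_ring V) (set fs) M = poly_coset L ` polys.adjoin_list V L fs"
proof (rule equalityI)
  interpret plain_module "poly_ring V :: 'k mpoly ring" M by (rule quotient_poly_ring_module)
  note simps = quotient_poly_ring_simps
  let ?J = "polys.adjoin_list V L fs"
  have J: "polys.is_ideal V ?J" by (rule polys.is_ideal_adjoin_list[OF L fs])
  have neg: "\<ominus>\<^bsub>M\<^esub> (poly_coset L p) = poly_coset L (- p)" if "p \<in> polys V" for p
    using that M.minus_equality[of "poly_coset L (- p)" "poly_coset L p"] by (simp add: simps)
  have "submodule (poly_coset L ` ?J) (poly_ring V) M"
  proof (rule submoduleI)
    show "poly_coset L ` ?J \<subseteq> carrier M" using polys.ideal_carrier[OF J] by (auto simp: simps)
    show "\<zero>\<^bsub>M\<^esub> \<in> poly_coset L ` ?J" using polys.ideal_zero[OF J] by (simp add: simps)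
    fix X assume "X \<in> poly_coset L ` ?J"
    then obtain p where p: "X = poly_coset L p" "p \<in> ?J" by auto
    note pV = polys.ideal_carrier[OF J p(2)]
    show "\<ominus>\<^bsub>M\<^esub> X \<in> poly_coset L ` ?J" using p pV polys.ideal_uminus[OF J] by (simp add: neg)
    { fix Y assume "Y \<in> poly_coset L ` ?J"
      then obtain q where q: "Y = poly_coset L q" "q \<in> ?J" by auto
      then show "X \<oplus>\<^bsub>M\<^esub> Y \<in> poly_coset L ` ?J"
        using p pV polys.ideal_carrier[OF J q(2)] polys.ideal_add[OF J] by (simp add: simps) }
    { fix a :: "'k mpoly" assume "a \<in> carrier (poly_ring V)"
      then show "a \<odot>\<^bsub>M\<^esub> X \<in> poly_coset L ` ?J"
        using p pV polys.ideal_mult[OF J] by (simp add: simps) }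
  qed
  moreover have "f \<odot>\<^bsub>M\<^esub> X \<in> poly_coset L ` ?J" if f: "f \<in> set fs" and X: "X \<in> carrier M" for f X
  proof -
    obtain p where p: "X = poly_coset L p" "p \<in> polys V" using X by (auto simp: simps)
    have "f * p \<in> ?J" by (rule polys.ideal_mult_right[OF J p(2) polys.adjoin_list_mem[OF L fs f]])
    then show ?thesis using p f fs by (auto simp: simps)
  qed
  ultimately show "smult_submodule (poly_ring V) (set fs) M \<subseteq> poly_coset L ` ?J"
    unfolding smult_submodule_def by (intro Inter_lower) simp
  show "poly_coset L ` ?J \<subseteq> smult_submodule (poly_ring V) (set fs) M"
    unfolding smult_submodule_def
  proof (rule Inter_greatest)
    fix N assume "N \<in> {N. submodule N (poly_ring V) M \<and> (\<forall>a\<in>set fs. \<forall>X\<in>carrier M. a \<odot>\<^bsub>M\<^esub> X \<in> N)}"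
    then have N: "submodule N (poly_ring V) M" and fN: "\<And>f X. f \<in> set fs \<Longrightarrow> X \<in> carrier M \<Longrightarrow> f \<odot>\<^bsub>M\<^esub> X \<in> N"
      by auto
    let ?K = "{p \<in> polys V. poly_coset L p \<in> N}"
    have N0: "poly_coset L 0 \<in> N"
      using subgroup.one_closed[OF submodule.axioms(1)[OF N]] by (simp add: simps)
    have K: "polys.is_ideal V ?K"
    proof (rule polys.is_idealI)
      fix x y assume "x \<in> ?K" "y \<in> ?K"
      then show "x + y \<in> ?K" using submoduleE(5)[OF N, of "poly_coset L x" "poly_coset L y"] by (simp add: simps)
    next
      fix a x :: "'k mpoly" assume "a \<in> polys V" "x \<in> ?K"
      then show "a * x \<in> ?K" using submoduleE(4)[OF N, of a "poly_coset L x"] by (simp add: simps)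
    qed (use N0 in auto)
    have "L \<subseteq> ?K"
    proof
      fix p assume p: "p \<in> L"
      then have "poly_coset L p = poly_coset L 0" by (simp add: poly_coset_eq_iff[OF L])
      then show "p \<in> ?K" using N0 polys.ideal_carrier[OF L p] by simp
    qed
    moreover have "set fs \<subseteq> ?K"
    proof
      fix f assume f: "f \<in> set fs"
      have "poly_coset L 1 \<in> carrier M" by (simp add: simps)
      from fN[OF f this] show "f \<in> ?K" using f fs by (auto simp: simps)
    qed
    ultimately have "?J \<subseteq> ?K" by (rule polys.adjoin_list_least[OF K])
    then show "poly_coset L ` ?J \<subseteq> N" by auto
  qed
qed

lemma coset_mem_smult_submodule:
  assumes fs: "set fs \<subseteq> polys V"
  shows "poly_coset L p \<in> smult_submodule (poly_ring V) (set fs) M \<longleftrightarrow> p \<in> polys.adjoin_list V L fs"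
proof -
  have "p \<in> polys.adjoin_list V L fs" if "q \<in> polys.adjoin_list V L fs" "p - q \<in> L" for q
    using polys.ideal_diff_iff[OF polys.is_ideal_adjoin_list[OF L fs], of p q] that
      polys.adjoin_list_superset[of L V fs] by blast
  then show ?thesis
    unfolding smult_submodule_quotient[OF fs] by (auto simp: poly_coset_eq_iff[OF L])
qed

lemma regular_sequence_iff:
  "regular_sequence (poly_ring V) M fs \<longleftrightarrow>
     set fs \<subseteq> polys V \<and> polys.weakly_regular V L fs \<and> polys.adjoin_list V L fs \<noteq> polys V"
proof (cases "set fs \<subseteq> polys V")
  case fs: True
  interpret plain_module "poly_ring V :: 'k mpoly ring" M by (rule quotient_poly_ring_module)
  note simps = quotient_poly_ring_simps
  have nzd: "nonzerodivisor_on (fs ! i) (quotient_module M (smult_submodule (poly_ring V) (set (take i fs)) M)) \<longleftrightarrow>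
      polys.nzd_mod V (polys.adjoin_list V L (take i fs)) (fs ! i)" if i: "i < length fs" for i
  proof -
    have tk: "set (take i fs) \<subseteq> polys V" using fs set_take_subset by fast
    have fi: "fs ! i \<in> polys V" using fs i by auto
    have sub: "submodule (smult_submodule (poly_ring V) (set (take i fs)) M) (poly_ring V) M"
      by (rule smult_submodule_is_submodule[OF tk])
    show ?thesis
      unfolding nonzerodivisor_on_quotient_iff[OF sub fi] polys.nzd_mod_def
      using fi by (auto simp: simps coset_mem_smult_submodule[OF tk])
  qed
  have J: "polys.is_ideal V (polys.adjoin_list V L fs)" by (rule polys.is_ideal_adjoin_list[OF L fs])
  have "smult_submodule (poly_ring V) (set fs) M = carrier M \<longleftrightarrow> polys.adjoin_list V L fs = polys V"
  proof
    assume eq: "smult_submodule (poly_ring V) (set fs) M = carrier M"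
    have "p \<in> polys.adjoin_list V L fs" if "p \<in> polys V" for p
      using coset_mem_smult_submodule[OF fs, of p] that unfolding eq by (simp add: simps)
    then show "polys.adjoin_list V L fs = polys V" using polys.ideal_carrier[OF J] by blast
  qed (simp add: smult_submodule_quotient[OF fs] simps)
  then show ?thesis
    using fs nzd by (auto simp: regular_sequence_def polys.weakly_regular_def)
qed (auto simp: regular_sequence_def)

text \<open>
  The number of steps in \<open>reg_depth\<close> is the length of every maximal regular sequence, so the description
  that defines the depth is met by exactly one number.
\<close>

theorem depth_eq_reg_depth:
  assumes V: "finite V" and m: "polys.is_ideal V m" and d: "polys.reg_depth V m n L"
  shows "depth (poly_ring V) m M = n"
proof -
  note len = polys.maximal_regular_length[OF polys_noetherian[OF V] m L d]
  have reg: "regular_sequence (poly_ring V) M fs \<longleftrightarrow> polys.weakly_regular V L fs" if "set fs \<subseteq> m" for fs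
    using len(2)[OF _ that] that polys.ideal_carrier[OF m] by (auto simp: regular_sequence_iff)
  have max: "maximal_regular_sequence_in (poly_ring V) m M fs \<longleftrightarrow>
      set fs \<subseteq> m \<and> polys.weakly_regular V L fs \<and> length fs = n" for fs
  proof (cases "set fs \<subseteq> m \<and> polys.weakly_regular V L fs")
    case True
    have "(\<exists>g\<in>m. polys.weakly_regular V L (fs @ [g])) \<longleftrightarrow> length fs < n"
      using len(3)[of fs] True len(1)[of "fs @ [_]"] by force
    then show ?thesis
      using True reg len(1)[of fs] by (auto simp: maximal_regular_sequence_in_def)
  qed (auto simp: maximal_regular_sequence_in_def reg)
  have "\<exists>fs. set fs \<subseteq> m \<and> polys.weakly_regular V L fs \<and> length fs = k" if "k \<le> n" for k
    using that
  proof (induction k)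
    case (Suc k)
    then obtain fs where fs: "set fs \<subseteq> m" "polys.weakly_regular V L fs" "length fs = k" by auto
    then obtain g where "g \<in> m" "polys.weakly_regular V L (fs @ [g])" using len(3)[of fs] Suc.prems by auto
    then show ?case using fs by (intro exI[of _ "fs @ [g]"]) simp
  qed auto
  then obtain fs where "set fs \<subseteq> m" "polys.weakly_regular V L fs" "length fs = n" by blast
  then show ?thesis unfolding depth_def max by (intro the_equality) auto
qed

end

section \<open>The depth of the Helm quotient\<close>

theorem theorem4p5:
  fixes n :: nat
    and A :: "'k::field mpoly ring"
    and L :: "'k mpoly set"
  assumes "n \<ge> 3"
    and "A = poly_ring (helm_vertices n)"
    and "L = CNI (helm_vertices n) (helm_edges n)"
  shows "depth A (graded_maximal_ideal (helm_vertices n)) (quotient_module (self_module A) L) = n"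
proof -
  have n: "n \<ge> 1" using assms(1) by simp
  have m: "polys.is_ideal (helm_vertices n) (graded_maximal_ideal (helm_vertices n) :: 'k mpoly set)"
    unfolding graded_maximal_ideal_def by (rule genideal_poly_ring(1)) auto
  have "finite (helm_vertices n)" by (simp add: helm_vertices_def)
  from depth_eq_reg_depth[OF helm_CNI_mem(1)[OF n] this m helm_reg_depth[OF n]]
  show ?thesis unfolding assms .
qed

end
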